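(* Let $\mathcal{A}$ be an operator ideal, let $X$ be a real Banach space and let $M$ be a complemented subspace of $X$. If $X$ has the Lip-$\mathcal{A}$-BAP, then so do $M$ and $X/M$.
   Context: All Banach spaces are real. A complemented subspace of $X$ is the range of a bounded linear projection on $X$. For Banach spaces $X,Y$, $\mathcal{L}(X,Y)$ is the space of bounded linear operators, and $\mathrm{Lip}_0(X,Y)$ is the Banach space of Lipschitz maps $f:X\to Y$ with $f(0)=0$, with norm $\|f\|_{\mathrm{Lip}}=\sup_{x\neq y}\|f(x)-f(y)\|/\|x-y\|$; $\mathrm{Lip}_0(X)=\mathrm{Lip}_0(X,\mathbb{R})$. For $x\in X$ let $\delta_x\in \mathrm{Lip}_0(X)^*$, $\delta_x(f)=f(x)$. The Lipschitz-free space is $\mathfrak{F}(X)=\overline{\mathrm{span}}\{\delta_x: x\in X\}\subseteq \mathrm{Lip}_0(X)^*$, and $\delta_X:X\to\mathfrak{F}(X)$, $\delta_X(x)=\delta_x$. For each $f\in\mathrm{Lip}_0(X,Y)$ there is a unique $L_f\in\mathcal{L}(\mathfrak{F}(X),Y)$ with $L_f\delta_X=f$, and $\|L_f\|=\|f\|_{\mathrm{Lip}}$. Operator ideals are (linear) operator ideals in the usual sense. For an operator ideal $\mathcal{A}$ and $\lambda\ge 1$: $\mathrm{Lip}_{\mathcal{A}}(X,Y)=\{f\in\mathrm{Lip}_0(X,Y): L_f\in\mathcal{A}(\mathfrak{F}(X),Y)\}$ and $\mathrm{Lip}_{\mathcal{A}}^\lambda(X,Y)=\{f\in\mathrm{Lip}_{\mathcal{A}}(X,Y):\|f\|_{\mathrm{Lip}}\le\lambda\}$.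 $\tau_c$ denotes the compact-open topology (uniform convergence on compact subsets of the domain). A Banach space $Z$ has the Lip-$\mathcal{A}$-BAP if $\mathrm{Id}_Z\in\overline{\mathrm{Lip}_{\mathcal{A}}^\lambda(Z,Z)}^{\tau_c}$ for some $\lambda\ge1$. *)

theory Defs
  imports "HOL-Analysis.Analysis"
begin

text \<open>
  An operator ideal is a family indexed by all pairs of Banach spaces, and the spaces
  \<open>X\<close>, \<open>M\<close>, \<open>X/M\<close> and their Lipschitz-free spaces live on different types.  Banach spaces
  are therefore records with an explicit carrier set, and maps between them are extensional
  functions on the carrier (so that equality of maps is equality on the carrier).
\<close>

section \<open>Real normed and Banach spaces\<close>

record 'a nspace =
  vcarrier :: "'a set"
  vzero :: 'a
  vadd :: "'a \<Rightarrow> 'a \<Rightarrow> 'a"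
  vscale :: "real \<Rightarrow> 'a \<Rightarrow> 'a"
  vnorm :: "'a \<Rightarrow> real"

definition vdiff :: "'a nspace \<Rightarrow> 'a \<Rightarrow> 'a \<Rightarrow> 'a" where
  "vdiff V x y = vadd V x (vscale V (-1) y)"

text \<open>The locale \<^locale>\<open>Metric_space\<close> wants a distance that is nonnegative and symmetric on
  the whole type, hence the value 0 off the carrier.\<close>

definition vdist :: "'a nspace \<Rightarrow> 'a \<Rightarrow> 'a \<Rightarrow> real" where
  "vdist V x y = (if x \<in> vcarrier V \<and> y \<in> vcarrier V then vnorm V (vdiff V x y) else 0)"

definition vtop :: "'a nspace \<Rightarrow> 'a topology" where
  "vtop V = Metric_space.mtopology (vcarrier V) (vdist V)"

locale normed_space =
  fixes V :: "'a nspace"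
  assumes zero_closed: "vzero V \<in> vcarrier V"
    and add_closed: "\<lbrakk>x \<in> vcarrier V; y \<in> vcarrier V\<rbrakk> \<Longrightarrow> vadd V x y \<in> vcarrier V"
    and scale_closed: "x \<in> vcarrier V \<Longrightarrow> vscale V a x \<in> vcarrier V"
    and add_assoc: "\<lbrakk>x \<in> vcarrier V; y \<in> vcarrier V; z \<in> vcarrier V\<rbrakk>
          \<Longrightarrow> vadd V (vadd V x y) z = vadd V x (vadd V y z)"
    and add_commute: "\<lbrakk>x \<in> vcarrier V; y \<in> vcarrier V\<rbrakk> \<Longrightarrow> vadd V x y = vadd V y x"
    and add_zero: "x \<in> vcarrier V \<Longrightarrow> vadd V x (vzero V) = x"
    and add_inverse: "x \<in> vcarrier V \<Longrightarrow> vdiff V x x = vzero V"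
    and scale_add_right: "\<lbrakk>x \<in> vcarrier V; y \<in> vcarrier V\<rbrakk>
          \<Longrightarrow> vscale V a (vadd V x y) = vadd V (vscale V a x) (vscale V a y)"
    and scale_add_left: "x \<in> vcarrier V
          \<Longrightarrow> vscale V (a + b) x = vadd V (vscale V a x) (vscale V b x)"
    and scale_scale: "x \<in> vcarrier V \<Longrightarrow> vscale V a (vscale V b x) = vscale V (a * b) x"
    and scale_one: "x \<in> vcarrier V \<Longrightarrow> vscale V 1 x = x"
    and norm_nonneg: "x \<in> vcarrier V \<Longrightarrow> 0 \<le> vnorm V x"
    and norm_eq_zero: "x \<in> vcarrier V \<Longrightarrow> vnorm V x = 0 \<longleftrightarrow> x = vzero V"
    and norm_scale: "x \<in> vcarrier V \<Longrightarrow> vnorm V (vscale V a x) = \<bar>a\<bar> * vnorm V x"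
    and norm_triangle: "\<lbrakk>x \<in> vcarrier V; y \<in> vcarrier V\<rbrakk>
          \<Longrightarrow> vnorm V (vadd V x y) \<le> vnorm V x + vnorm V y"

locale banach_space = normed_space +
  assumes complete: "Metric_space.mcomplete (vcarrier V) (vdist V)"

definition real_space :: "real nspace" where
  "real_space = \<lparr>vcarrier = UNIV, vzero = 0, vadd = (+), vscale = (*), vnorm = abs\<rparr>"


section \<open>Bounded linear operators\<close>

definition linear_maps :: "'a nspace \<Rightarrow> 'b nspace \<Rightarrow> ('a \<Rightarrow> 'b) set" where
  "linear_maps E F = {T \<in> vcarrier E \<rightarrow>\<^sub>E vcarrier F.
     (\<forall>x\<in>vcarrier E. \<forall>y\<in>vcarrier E. T (vadd E x y) = vadd F (T x) (T y)) \<and>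
     (\<forall>a. \<forall>x\<in>vcarrier E. T (vscale E a x) = vscale F a (T x))}"

definition bounded_ops :: "'a nspace \<Rightarrow> 'b nspace \<Rightarrow> ('a \<Rightarrow> 'b) set" where
  "bounded_ops E F = {T \<in> linear_maps E F.
     \<exists>K. \<forall>x\<in>vcarrier E. vnorm F (T x) \<le> K * vnorm E x}"

definition fun_zero :: "'a set \<Rightarrow> 'b nspace \<Rightarrow> 'a \<Rightarrow> 'b" where
  "fun_zero S F = (\<lambda>x\<in>S. vzero F)"

definition fun_add :: "'a set \<Rightarrow> 'b nspace \<Rightarrow> ('a \<Rightarrow> 'b) \<Rightarrow> ('a \<Rightarrow> 'b) \<Rightarrow> 'a \<Rightarrow> 'b" where
  "fun_add S F f g = (\<lambda>x\<in>S. vadd F (f x) (g x))"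

definition fun_scale :: "'a set \<Rightarrow> 'b nspace \<Rightarrow> real \<Rightarrow> ('a \<Rightarrow> 'b) \<Rightarrow> 'a \<Rightarrow> 'b" where
  "fun_scale S F a f = (\<lambda>x\<in>S. vscale F a (f x))"

definition op_space :: "'a nspace \<Rightarrow> 'b nspace \<Rightarrow> ('a \<Rightarrow> 'b) nspace" where
  "op_space E F = \<lparr>vcarrier = bounded_ops E F,
     vzero = fun_zero (vcarrier E) F,
     vadd = fun_add (vcarrier E) F,
     vscale = fun_scale (vcarrier E) F,
     vnorm = (\<lambda>T. SUP x\<in>{x \<in> vcarrier E. vnorm E x \<le> 1}. vnorm F (T x))\<rparr>"

definition dual_space :: "'a nspace \<Rightarrow> ('a \<Rightarrow> real) nspace" where
  "dual_space E = op_space E real_space"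

definition isometric_isos :: "'a nspace \<Rightarrow> 'b nspace \<Rightarrow> ('a \<Rightarrow> 'b) set" where
  "isometric_isos E F = {J \<in> linear_maps E F. bij_betw J (vcarrier E) (vcarrier F) \<and>
     (\<forall>x\<in>vcarrier E. vnorm F (J x) = vnorm E x)}"


section \<open>Subspaces, quotients, complemented subspaces\<close>

definition linear_subspace :: "'a nspace \<Rightarrow> 'a set \<Rightarrow> bool" where
  "linear_subspace V S \<longleftrightarrow> S \<subseteq> vcarrier V \<and> vzero V \<in> S \<and>
     (\<forall>x\<in>S. \<forall>y\<in>S. vadd V x y \<in> S) \<and> (\<forall>a. \<forall>x\<in>S. vscale V a x \<in> S)"

definition lspan :: "'a nspace \<Rightarrow> 'a set \<Rightarrow> 'a set" where
  "lspan V B = \<Inter>{S. linear_subspace V S \<and> B \<subseteq> S}"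

definition sub_space :: "'a nspace \<Rightarrow> 'a set \<Rightarrow> 'a nspace" where
  "sub_space V M = V\<lparr>vcarrier := M\<rparr>"

definition complemented_subspace :: "'a nspace \<Rightarrow> 'a set \<Rightarrow> bool" where
  "complemented_subspace X M \<longleftrightarrow>
     (\<exists>P\<in>bounded_ops X X. (\<forall>x\<in>vcarrier X. P (P x) = P x) \<and> P ` vcarrier X = M)"

text \<open>Elements of the quotient are cosets.  In the scalar multiplication the summand \<open>m\<close>
  matters only for the scalar 0, where \<open>0 \<cdot> C\<close> has to be \<open>M\<close> and not \<open>{0}\<close>.\<close>

definition quotient_space :: "'a nspace \<Rightarrow> 'a set \<Rightarrow> 'a set nspace" where
  "quotient_space X M = \<lparr>vcarrier = (\<lambda>x. vadd X x ` M) ` vcarrier X,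
     vzero = M,
     vadd = (\<lambda>C D. {vadd X c d | c d. c \<in> C \<and> d \<in> D}),
     vscale = (\<lambda>a C. {vadd X (vscale X a c) m | c m. c \<in> C \<and> m \<in> M}),
     vnorm = (\<lambda>C. INF c\<in>C. vnorm X c)\<rparr>"


section \<open>Lipschitz maps and the Lipschitz-free space\<close>

definition Lip0 :: "'a nspace \<Rightarrow> 'b nspace \<Rightarrow> ('a \<Rightarrow> 'b) set" where
  "Lip0 X Y = {f \<in> vcarrier X \<rightarrow>\<^sub>E vcarrier Y. f (vzero X) = vzero Y \<and>
     (\<exists>K. \<forall>x\<in>vcarrier X. \<forall>y\<in>vcarrier X. vdist Y (f x) (f y) \<le> K * vdist X x y)}"

text \<open>The inserted 0 is the value of the supremum when \<open>X\<close> is the zero space.\<close>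

definition lip_norm :: "'a nspace \<Rightarrow> 'b nspace \<Rightarrow> ('a \<Rightarrow> 'b) \<Rightarrow> real" where
  "lip_norm X Y f = Sup (insert 0 {vdist Y (f x) (f y) / vdist X x y | x y.
     x \<in> vcarrier X \<and> y \<in> vcarrier X \<and> x \<noteq> y})"

definition Lip0_space :: "'a nspace \<Rightarrow> 'b nspace \<Rightarrow> ('a \<Rightarrow> 'b) nspace" where
  "Lip0_space X Y = \<lparr>vcarrier = Lip0 X Y,
     vzero = fun_zero (vcarrier X) Y,
     vadd = fun_add (vcarrier X) Y,
     vscale = fun_scale (vcarrier X) Y,
     vnorm = lip_norm X Y\<rparr>"

definition delta :: "'a nspace \<Rightarrow> 'a \<Rightarrow> ('a \<Rightarrow> real) \<Rightarrow> real" where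
  "delta X x = (\<lambda>f\<in>Lip0 X real_space. f x)"

definition free_space :: "'a nspace \<Rightarrow> (('a \<Rightarrow> real) \<Rightarrow> real) nspace" where
  "free_space X = (let D = dual_space (Lip0_space X real_space) in
     sub_space D (vtop D closure_of lspan D (delta X ` vcarrier X)))"

definition lip_linearization ::
    "'a nspace \<Rightarrow> 'b nspace \<Rightarrow> ('a \<Rightarrow> 'b) \<Rightarrow> (('a \<Rightarrow> real) \<Rightarrow> real) \<Rightarrow> 'b" where
  "lip_linearization X Y f = (THE L. L \<in> bounded_ops (free_space X) Y \<and>
     (\<forall>x\<in>vcarrier X. L (delta X x) = f x))"


section \<open>Operator ideals\<close>

text \<open>
  A type \<open>'u\<close> plays the role of the universe: an operator ideal assigns to every pair of
  Banach spaces whose points are taken from \<open>'u\<close> a set of bounded operators.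
\<close>

type_synonym 'u op_family = "'u nspace \<Rightarrow> 'u nspace \<Rightarrow> ('u \<Rightarrow> 'u) set"

definition finite_rank_ops :: "'a nspace \<Rightarrow> 'b nspace \<Rightarrow> ('a \<Rightarrow> 'b) set" where
  "finite_rank_ops E F = {T \<in> bounded_ops E F.
     \<exists>B. finite B \<and> B \<subseteq> vcarrier F \<and> T ` vcarrier E \<subseteq> lspan F B}"

definition operator_ideal :: "'u op_family \<Rightarrow> bool" where
  "operator_ideal A \<longleftrightarrow>
     (\<forall>E F. banach_space E \<and> banach_space F \<longrightarrow>
        linear_subspace (op_space E F) (A E F) \<and> finite_rank_ops E F \<subseteq> A E F) \<and>
     (\<forall>E0 E F F0 R T S. banach_space E0 \<and> banach_space E \<and> banach_space F \<and> banach_space F0 \<and>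
        R \<in> bounded_ops E0 E \<and> T \<in> A E F \<and> S \<in> bounded_ops F F0 \<longrightarrow>
        compose (vcarrier E0) S (compose (vcarrier E0) T R) \<in> A E0 F0)"

text \<open>
  Membership in the ideal for an operator between Banach spaces on arbitrary types: transport
  both spaces isometrically to spaces with points in \<open>'u\<close>.  By \<open>in_ideal_iff\<close> below the choice of
  the copies is irrelevant, and by \<open>isometric_copy_exists\<close> copies exist as soon as \<open>'u\<close> has at
  least as many points as the two spaces.
\<close>

definition in_ideal :: "'u op_family \<Rightarrow> 'a nspace \<Rightarrow> 'b nspace \<Rightarrow> ('a \<Rightarrow> 'b) \<Rightarrow> bool" where
  "in_ideal A E F T \<longleftrightarrow> T \<in> bounded_ops E F \<and>
     (\<exists>E' F' I J. banach_space E' \<and> banach_space F' \<and>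
        I \<in> isometric_isos E E' \<and> J \<in> isometric_isos F F' \<and>
        (\<exists>T'\<in>A E' F'. \<forall>x\<in>vcarrier E. T' (I x) = J (T x)))"


section \<open>The Lipschitz approximation property of an operator ideal\<close>

definition Lip_ideal :: "'u op_family \<Rightarrow> 'a nspace \<Rightarrow> 'b nspace \<Rightarrow> ('a \<Rightarrow> 'b) set" where
  "Lip_ideal A X Y = {f \<in> Lip0 X Y. in_ideal A (free_space X) Y (lip_linearization X Y f)}"

definition Lip_ideal_bdd :: "'u op_family \<Rightarrow> real \<Rightarrow> 'a nspace \<Rightarrow> 'b nspace \<Rightarrow> ('a \<Rightarrow> 'b) set" where
  "Lip_ideal_bdd A l X Y = {f \<in> Lip_ideal A X Y. lip_norm X Y f \<le> l}"

definition cont_maps :: "'a nspace \<Rightarrow> 'b nspace \<Rightarrow> ('a \<Rightarrow> 'b) set" where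
  "cont_maps X Y = {f \<in> vcarrier X \<rightarrow>\<^sub>E vcarrier Y. continuous_map (vtop X) (vtop Y) f}"

definition tau_c :: "'a nspace \<Rightarrow> 'b nspace \<Rightarrow> ('a \<Rightarrow> 'b) topology" where
  "tau_c X Y = topology_generated_by
     {{f \<in> cont_maps X Y. f ` K \<subseteq> U} | K U. compactin (vtop X) K \<and> openin (vtop Y) U}"

definition Lip_BAP :: "'u op_family \<Rightarrow> 'a nspace \<Rightarrow> bool" where
  "Lip_BAP A Z \<longleftrightarrow>
     (\<exists>l\<ge>1. (\<lambda>z\<in>vcarrier Z. z) \<in> tau_c Z Z closure_of Lip_ideal_bdd A l Z Z)"


section \<open>Membership in the ideal does not depend on the chosen copies\<close>

lemma linear_maps_closed: "T \<in> linear_maps E F \<Longrightarrow> x \<in> vcarrier E \<Longrightarrow> T x \<in> vcarrier F"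
  unfolding linear_maps_def by auto

lemma isometric_isos_bounded: "J \<in> isometric_isos E F \<Longrightarrow> J \<in> bounded_ops E F"
  unfolding isometric_isos_def bounded_ops_def by (auto intro!: exI[of _ 1])

lemma isometric_isos_inverse:
  assumes J: "J \<in> isometric_isos E F" and E: "normed_space E"
  shows "(\<lambda>y\<in>vcarrier F. inv_into (vcarrier E) J y) \<in> isometric_isos F E"
proof -
  interpret E: normed_space E by fact
  have lin: "J \<in> linear_maps E F" and bij: "bij_betw J (vcarrier E) (vcarrier F)"
    and nrm: "\<And>x. x \<in> vcarrier E \<Longrightarrow> vnorm F (J x) = vnorm E x"
    using J unfolding isometric_isos_def by auto
  let ?I = "inv_into (vcarrier E) J"
  have I_in: "?I y \<in> vcarrier E" and JI: "J (?I y) = y" if "y \<in> vcarrier F" for y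
    using that bij by (auto simp: bij_betw_def inv_into_into f_inv_into_f)
  have IJ: "?I (J x) = x" if "x \<in> vcarrier E" for x
    using that bij by (simp add: bij_betw_def)
  have Jadd: "J (vadd E x y) = vadd F (J x) (J y)" if "x \<in> vcarrier E" "y \<in> vcarrier E" for x y
    using lin that unfolding linear_maps_def by auto
  have Jsc: "J (vscale E a x) = vscale F a (J x)" if "x \<in> vcarrier E" for a x
    using lin that unfolding linear_maps_def by auto
  have Jin: "J x \<in> vcarrier F" if "x \<in> vcarrier E" for x
    using linear_maps_closed[OF lin that] .
  have Jadd': "J (vadd E (?I y) (?I z)) = vadd F y z" if "y \<in> vcarrier F" "z \<in> vcarrier F" for y z
    using Jadd[OF I_in[OF that(1)] I_in[OF that(2)]] that by (simp only: JI)
  have Jsc': "J (vscale E a (?I y)) = vscale F a y" if "y \<in> vcarrier F" for a y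
    using Jsc[OF I_in[OF that]] that by (simp only: JI)
  have add: "?I (vadd F y z) = vadd E (?I y) (?I z)" and addin: "vadd F y z \<in> vcarrier F"
    if "y \<in> vcarrier F" "z \<in> vcarrier F" for y z
    using IJ[OF E.add_closed[OF I_in[OF that(1)] I_in[OF that(2)]]]
      Jin[OF E.add_closed[OF I_in[OF that(1)] I_in[OF that(2)]]]
    unfolding Jadd'[OF that] by this+
  have sc: "?I (vscale F a y) = vscale E a (?I y)" and scin: "vscale F a y \<in> vcarrier F"
    if "y \<in> vcarrier F" for a y
    using IJ[OF E.scale_closed[OF I_in[OF that]]] Jin[OF E.scale_closed[OF I_in[OF that]]]
    unfolding Jsc'[OF that] by this+
  have "bij_betw (\<lambda>y\<in>vcarrier F. ?I y) (vcarrier F) (vcarrier E)"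
    using bij_betw_inv_into[OF bij] by (simp cong: bij_betw_cong)
  moreover have "vnorm E (?I y) = vnorm F y" if "y \<in> vcarrier F" for y
    using nrm[OF I_in[OF that]] JI[OF that] by simp
  ultimately show ?thesis
    unfolding isometric_isos_def linear_maps_def by (auto simp: add addin sc scin I_in)
qed

lemma bounded_ops_compose:
  assumes R: "R \<in> bounded_ops E F" and S: "S \<in> bounded_ops F G"
    and F: "normed_space F" and E: "normed_space E" and G: "normed_space G"
  shows "compose (vcarrier E) S R \<in> bounded_ops E G"
proof -
  interpret E: normed_space E by fact
  interpret F: normed_space F by fact
  interpret G: normed_space G by fact
  obtain K where K: "\<And>x. x \<in> vcarrier E \<Longrightarrow> vnorm F (R x) \<le> K * vnorm E x"
    using R unfolding bounded_ops_def by auto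
  obtain L where L: "\<And>x. x \<in> vcarrier F \<Longrightarrow> vnorm G (S x) \<le> L * vnorm F x"
    using S unfolding bounded_ops_def by auto
  have RL: "R \<in> linear_maps E F" and SL: "S \<in> linear_maps F G"
    using R S by (simp_all add: bounded_ops_def)
  note Rin = linear_maps_closed[OF RL] and Sin = linear_maps_closed[OF SL]
  have Radd: "\<And>x y. \<lbrakk>x \<in> vcarrier E; y \<in> vcarrier E\<rbrakk> \<Longrightarrow> R (vadd E x y) = vadd F (R x) (R y)"
    and Rsc: "\<And>a x. x \<in> vcarrier E \<Longrightarrow> R (vscale E a x) = vscale F a (R x)"
    using RL by (simp_all add: linear_maps_def)
  have Sadd: "\<And>x y. \<lbrakk>x \<in> vcarrier F; y \<in> vcarrier F\<rbrakk> \<Longrightarrow> S (vadd F x y) = vadd G (S x) (S y)"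
    and Ssc: "\<And>a x. x \<in> vcarrier F \<Longrightarrow> S (vscale F a x) = vscale G a (S x)"
    using SL by (simp_all add: linear_maps_def)
  have "vnorm G (S (R x)) \<le> \<bar>L\<bar> * \<bar>K\<bar> * vnorm E x" if x: "x \<in> vcarrier E" for x
  proof -
    have "vnorm G (S (R x)) \<le> L * vnorm F (R x)" by (rule L[OF Rin[OF x]])
    also have "\<dots> \<le> \<bar>L\<bar> * vnorm F (R x)"
      by (rule mult_right_mono[OF abs_ge_self F.norm_nonneg[OF Rin[OF x]]])
    also have "\<dots> \<le> \<bar>L\<bar> * (K * vnorm E x)"
      by (rule mult_left_mono[OF K[OF x] abs_ge_zero])
    also have "\<dots> \<le> \<bar>L\<bar> * (\<bar>K\<bar> * vnorm E x)"
      by (rule mult_left_mono[OF mult_right_mono[OF abs_ge_self E.norm_nonneg[OF x]] abs_ge_zero])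
    finally show ?thesis by (simp only: mult.assoc)
  qed
  then have "\<exists>C. \<forall>x\<in>vcarrier E. vnorm G (compose (vcarrier E) S R x) \<le> C * vnorm E x"
    by (intro exI[of _ "\<bar>L\<bar> * \<bar>K\<bar>"]) (simp add: compose_def)
  moreover have "compose (vcarrier E) S R \<in> linear_maps E G"
    by (simp add: linear_maps_def compose_def Rin Sin Radd Rsc Sadd Ssc E.add_closed E.scale_closed)
  ultimately show ?thesis
    by (simp add: bounded_ops_def)
qed

lemma in_ideal_iff:
  fixes A :: "'u op_family" and E :: "'a nspace" and F :: "'b nspace"
  assumes A: "operator_ideal A" and E: "banach_space E" and F: "banach_space F"
    and E': "banach_space E'" and F': "banach_space F'"
    and I: "I \<in> isometric_isos E E'" and J: "J \<in> isometric_isos F F'"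
    and T: "T \<in> bounded_ops E F"
  shows "in_ideal A E F T \<longleftrightarrow>
    (\<lambda>u\<in>vcarrier E'. J (T (inv_into (vcarrier E) I u))) \<in> A E' F'" (is "_ \<longleftrightarrow> ?T' \<in> _")
proof
  note ns = banach_space.axioms(1)
  have bI: "bij_betw I (vcarrier E) (vcarrier E')"
    using I unfolding isometric_isos_def by simp
  have Iinv: "inv_into (vcarrier E) I u \<in> vcarrier E" if "u \<in> vcarrier E'" for u
    using that bI by (auto simp: bij_betw_def inv_into_into)
  {
    assume "?T' \<in> A E' F'"
    moreover have "?T' (I x) = J (T x)" if "x \<in> vcarrier E" for x
      using that bI by (auto simp: bij_betw_def)
    ultimately show "in_ideal A E F T"
      unfolding in_ideal_def using T E' F' I J by blast
  }
  assume "in_ideal A E F T"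
  then obtain E2 F2 I2 J2 T2 where E2: "banach_space E2" and F2: "banach_space F2"
    and I2: "I2 \<in> isometric_isos E E2" and J2: "J2 \<in> isometric_isos F F2"
    and T2: "T2 \<in> A E2 F2" and com: "\<And>x. x \<in> vcarrier E \<Longrightarrow> T2 (I2 x) = J2 (T x)"
    unfolding in_ideal_def by blast
  define R where "R = compose (vcarrier E') I2 (\<lambda>u\<in>vcarrier E'. inv_into (vcarrier E) I u)"
  define S where "S = compose (vcarrier F2) J (\<lambda>v\<in>vcarrier F2. inv_into (vcarrier F) J2 v)"
  have R: "R \<in> bounded_ops E' E2"
    unfolding R_def using ns[OF E] ns[OF E'] ns[OF E2]
    by (intro bounded_ops_compose[where F = E]
        isometric_isos_bounded[OF isometric_isos_inverse[OF I]] isometric_isos_bounded[OF I2]) auto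
  have S: "S \<in> bounded_ops F2 F'"
    unfolding S_def using ns[OF F] ns[OF F'] ns[OF F2]
    by (intro bounded_ops_compose[where F = F]
        isometric_isos_bounded[OF isometric_isos_inverse[OF J2]] isometric_isos_bounded[OF J]) auto
  have bJ2: "bij_betw J2 (vcarrier F) (vcarrier F2)"
    using J2 unfolding isometric_isos_def by simp
  have Tin: "T x \<in> vcarrier F" if "x \<in> vcarrier E" for x
    using T that unfolding bounded_ops_def by (auto intro: linear_maps_closed)
  have "compose (vcarrier E') S (compose (vcarrier E') T2 R) \<in> A E' F'"
    using A E' E2 F2 F' R T2 S unfolding operator_ideal_def by blast
  also have "compose (vcarrier E') S (compose (vcarrier E') T2 R) = ?T'"
  proof
    fix u
    show "compose (vcarrier E') S (compose (vcarrier E') T2 R) u = ?T' u"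
    proof (cases "u \<in> vcarrier E'")
      case True
      let ?x = "inv_into (vcarrier E) I u"
      have "J2 (T ?x) \<in> vcarrier F2" "inv_into (vcarrier F) J2 (J2 (T ?x)) = T ?x"
        using bJ2 Tin[OF Iinv[OF True]] by (auto simp: bij_betw_def)
      then show ?thesis
        using True com[OF Iinv[OF True]] by (simp add: compose_def R_def S_def)
    qed (simp add: compose_def)
  qed
  finally show "?T' \<in> A E' F'" .
qed

corollary in_ideal_same_universe:
  fixes A :: "'u op_family" and E F :: "'u nspace"
  assumes A: "operator_ideal A" and E: "banach_space E" and F: "banach_space F"
  shows "in_ideal A E F T \<longleftrightarrow> T \<in> A E F"
proof -
  have id: "(\<lambda>x\<in>vcarrier V. x) \<in> isometric_isos V V" if "banach_space V" for V :: "'u nspace"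
  proof -
    interpret banach_space V by fact
    show ?thesis
      by (simp add: isometric_isos_def linear_maps_def add_closed scale_closed bij_betw_def inj_on_def)
  qed
  have AT: "T \<in> bounded_ops E F" if "T \<in> A E F"
  proof -
    have "linear_subspace (op_space E F) (A E F)"
      using A E F unfolding operator_ideal_def by blast
    then show ?thesis
      using that by (auto simp: linear_subspace_def op_space_def)
  qed
  show ?thesis
  proof (cases "T \<in> bounded_ops E F")
    case True
    have inv: "inv_into (vcarrier E) (\<lambda>x\<in>vcarrier E. x) u = u" if "u \<in> vcarrier E" for u
      using inv_into_f_f[of "\<lambda>x\<in>vcarrier E. x" "vcarrier E" u] that by (simp add: inj_on_def)
    have "(\<lambda>u\<in>vcarrier E. (\<lambda>x\<in>vcarrier F. x)
        (T (inv_into (vcarrier E) (\<lambda>x\<in>vcarrier E. x) u))) = T"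
    proof
      fix u
      have T: "T \<in> vcarrier E \<rightarrow>\<^sub>E vcarrier F"
        using True by (simp add: bounded_ops_def linear_maps_def)
      show "(\<lambda>u\<in>vcarrier E. (\<lambda>x\<in>vcarrier F. x)
          (T (inv_into (vcarrier E) (\<lambda>x\<in>vcarrier E. x) u))) u = T u"
        by (cases "u \<in> vcarrier E") (simp_all add: inv PiE_mem[OF T] PiE_arb[OF T])
    qed
    then show ?thesis
      using in_ideal_iff[OF A E F E F id[OF E] id[OF F] True] by simp
  next
    case False
    then show ?thesis using AT unfolding in_ideal_def by blast
  qed
qed

lemma (in normed_space) vdist_metric: "Metric_space (vcarrier V) (vdist V)"
proof
  have neg: "vdiff V y x = vscale V (-1) (vdiff V x y)"
    if "x \<in> vcarrier V" "y \<in> vcarrier V" for x y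
    using that by (simp add: vdiff_def scale_add_right scale_scale scale_one scale_closed add_commute)
  have left_zero: "vadd V (vzero V) x = x" if "x \<in> vcarrier V" for x
    using add_commute[OF zero_closed that] add_zero[OF that] by simp
  have left_inverse: "vadd V (vscale V (-1) x) x = vzero V" if "x \<in> vcarrier V" for x
    using add_commute[OF scale_closed[OF that] that] add_inverse[OF that] by (simp add: vdiff_def)
  have cancel: "vadd V (vdiff V x y) (vadd V y w) = vadd V x w"
    if "x \<in> vcarrier V" "y \<in> vcarrier V" "w \<in> vcarrier V" for x y w
  proof -
    have "vadd V (vdiff V x y) (vadd V y w)
        = vadd V x (vadd V (vscale V (-1) y) (vadd V y w))"
      unfolding vdiff_def using that by (intro add_assoc add_closed scale_closed)
    also have "vadd V (vscale V (-1) y) (vadd V y w) = vadd V (vadd V (vscale V (-1) y) y) w"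
      using that by (intro add_assoc[symmetric] scale_closed)
    also have "\<dots> = w"
      using that by (simp only: left_inverse left_zero)
    finally show ?thesis .
  qed
  have split: "vdiff V x z = vadd V (vdiff V x y) (vdiff V y z)"
    if "x \<in> vcarrier V" "y \<in> vcarrier V" "z \<in> vcarrier V" for x y z
    using cancel[OF that(1,2) scale_closed[OF that(3)]] by (simp add: vdiff_def)
  have diff_closed: "vdiff V x y \<in> vcarrier V" if "x \<in> vcarrier V" "y \<in> vcarrier V" for x y
    using that by (simp add: vdiff_def add_closed scale_closed)
  show "0 \<le> vdist V x y" for x y
    by (simp add: vdist_def norm_nonneg diff_closed)
  show "vdist V x y = vdist V y x" for x y
    unfolding vdist_def using neg[of y x] norm_scale[of "vdiff V y x" "-1"] diff_closed by auto
  show "(vdist V x y = 0) = (x = y)" if "x \<in> vcarrier V" "y \<in> vcarrier V" for x y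
  proof
    assume "vdist V x y = 0"
    then have "vdiff V x y = vzero V"
      using that diff_closed norm_eq_zero by (simp add: vdist_def)
    then have "vadd V (vdiff V x y) y = y"
      using that by (simp add: left_zero)
    moreover have "vadd V (vdiff V x y) y = x"
      using cancel[OF that zero_closed] that by (simp add: add_zero)
    ultimately show "x = y" by simp
  next
    assume "x = y"
    then show "vdist V x y = 0"
      using that by (simp add: vdist_def add_inverse norm_eq_zero zero_closed)
  qed
  show "vdist V x z \<le> vdist V x y + vdist V y z"
    if "x \<in> vcarrier V" "y \<in> vcarrier V" "z \<in> vcarrier V" for x y z
    using that norm_triangle[of "vdiff V x y" "vdiff V y z"] split[of x y z] diff_closed
    by (simp add: vdist_def)
qed

lemma isometric_copy_exists:
  fixes V :: "'a nspace" and h :: "'a \<Rightarrow> 'u"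
  assumes V: "banach_space V" and h: "inj_on h (vcarrier V)"
  shows "\<exists>(W::'u nspace) J. banach_space W \<and> J \<in> isometric_isos V W"
proof -
  interpret banach_space V by fact
  let ?C = "vcarrier V"
  define g where "g = inv_into ?C h"
  have gh: "g (h x) = x" if "x \<in> ?C" for x using h that by (simp add: g_def)
  define W :: "'u nspace" where "W = \<lparr>vcarrier = h ` ?C, vzero = h (vzero V),
    vadd = (\<lambda>x y. h (vadd V (g x) (g y))), vscale = (\<lambda>a x. h (vscale V a (g x))),
    vnorm = (\<lambda>x. vnorm V (g x))\<rparr>"
  have simps: "vcarrier W = h ` ?C" "vzero W = h (vzero V)"
    "vadd W x y = h (vadd V (g x) (g y))" "vscale W a x = h (vscale V a (g x))"
    "vnorm W x = vnorm V (g x)" for x y a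
    by (simp_all add: W_def)
  note cl = zero_closed add_closed scale_closed
  have W: "normed_space W"
  proof
    show "vdiff W x x = vzero W" if "x \<in> vcarrier W" for x
      using that add_inverse by (auto simp: simps vdiff_def gh cl)
    show "vnorm W x = 0 \<longleftrightarrow> x = vzero W" if "x \<in> vcarrier W" for x
      using that by (auto simp: simps gh cl norm_eq_zero)
    show "vadd W x y = vadd W y x" if "x \<in> vcarrier W" "y \<in> vcarrier W" for x y
      using that by (auto simp: simps gh add_commute)
  qed (auto simp: simps gh cl add_assoc add_zero scale_add_right scale_add_left scale_scale
      scale_one norm_nonneg norm_scale norm_triangle)
  have d: "vdist W (h x) (h y) = vdist V x y" if "x \<in> ?C" "y \<in> ?C" for x y
    using that by (auto simp: vdist_def vdiff_def simps gh cl)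
  interpret MV: Metric_space "vcarrier V" "vdist V" by (rule vdist_metric)
  interpret MW: Metric_space "vcarrier W" "vdist W" by (rule normed_space.vdist_metric[OF W])
  have "MW.mcomplete"
    unfolding MW.mcomplete_def
  proof (intro allI impI)
    fix s assume s: "MW.MCauchy s"
    then have sW: "s n \<in> vcarrier W" for n
      by (auto simp: MW.MCauchy_def)
    have gC: "g (s n) \<in> ?C" and hg: "h (g (s n)) = s n" for n
      using sW[of n] gh by (auto simp: simps)
    have ds: "vdist W (s m) (s n) = vdist V (g (s m)) (g (s n))" for m n
      using d[OF gC gC] by (simp add: hg)
    have "MV.MCauchy (g \<circ> s)"
      using s gC by (auto simp: MV.MCauchy_def MW.MCauchy_def ds)
    then obtain x where x: "limitin MV.mtopology (g \<circ> s) x sequentially"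
      using complete unfolding MV.mcomplete_def by blast
    then have xC: "x \<in> ?C" by (simp add: MV.limit_metric_sequentially)
    then have hx: "h x \<in> vcarrier W" by (simp add: simps)
    have "vdist W (s n) (h x) = vdist V (g (s n)) x" for n
      using d[OF gC xC] by (simp add: hg)
    then have "limitin MW.mtopology s (h x) sequentially"
      using x hx sW gC by (simp add: MV.limit_metric_sequentially MW.limit_metric_sequentially)
    then show "\<exists>x. limitin MW.mtopology s x sequentially" by blast
  qed
  then have "banach_space W"
    using W by (simp add: banach_space_def banach_space_axioms_def)
  moreover have "(\<lambda>x\<in>?C. h x) \<in> isometric_isos V W"
    using h unfolding isometric_isos_def linear_maps_def
    by (auto simp: simps gh cl bij_betw_def inj_on_def)
  ultimately show ?thesis by blast
qed

end

theory Submission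
  imports Defs
begin

text \<open>
  Both halves are instances of one fact, \<open>Lip_BAP_retract\<close>: the property passes from \<open>X\<close> to every
  space \<open>Z\<close> that is a linear retract of \<open>X\<close>, that is, for which there are bounded operators
  \<open>R : Z \<rightarrow> X\<close> and \<open>S : X \<rightarrow> Z\<close> with \<open>S R = Id\<close>.  For \<open>Z = M\<close> take the inclusion and the projection
  \<open>P\<close>; for \<open>Z = X/M\<close> take \<open>x + M \<mapsto> x - P x\<close> and the quotient map.

  For the retract, send \<open>f : X \<rightarrow> X\<close> to \<open>S f R : Z \<rightarrow> Z\<close>.  This operation is continuous for the
  compact-open topologies, multiplies Lipschitz constants by at most \<open>\<parallel>S\<parallel> \<parallel>R\<parallel>\<close>, and takes the
  identity of \<open>X\<close> to the identity of \<open>Z\<close>.  It also respects the ideal: if \<open>\<rho> : F(Z) \<rightarrow> F(X)\<close> is the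
  linearization of \<open>\<delta>\<^sub>X R\<close>, then \<open>S L\<^sub>f \<rho>\<close> is bounded, linear and agrees with \<open>S f R\<close> on the points
  \<open>\<delta>\<^sub>z\<close>, so it is the linearization of \<open>S f R\<close>.

  Membership in the ideal refers to isometric copies with points in the type \<open>'u\<close>, and it has to be
  shown that \<open>'u\<close> has room for them.  Copies of \<open>Z\<close> and \<open>F(Z)\<close> exist because copies of \<open>X\<close> and
  \<open>F(X)\<close> do: \<open>R\<close> is injective, and \<open>\<rho>\<close> is injective because the linearization of \<open>\<delta>\<^sub>Z S\<close> is a left inverse of it.

  The argument needs linearizations to exist, be unique and be bounded.  Uniqueness is density of
  the span of the \<open>\<delta>\<^sub>x\<close>.  For existence the value \<open>L\<^sub>f(m)\<close> is characterized by duality, as the \<open>y\<close>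
  with \<open>\<phi>(y) = m(\<phi> f)\<close> for every functional \<open>\<phi>\<close> of norm at most 1.  That such a \<open>y\<close> is controlled
  by \<open>m\<close> is the Hahn--Banach theorem, which is proved here in the form that every vector has a
  norming functional.
\<close>

section \<open>Algebra and topology in normed spaces\<close>

context normed_space
begin

lemma zero_add: "x \<in> vcarrier V \<Longrightarrow> vadd V (vzero V) x = x"
  using add_commute[OF zero_closed] add_zero by metis

lemma diff_closed: "\<lbrakk>x \<in> vcarrier V; y \<in> vcarrier V\<rbrakk> \<Longrightarrow> vdiff V x y \<in> vcarrier V"
  by (simp add: vdiff_def add_closed scale_closed)

lemma add_left_commute:
  assumes "x \<in> vcarrier V" "y \<in> vcarrier V" "z \<in> vcarrier V"
  shows "vadd V x (vadd V y z) = vadd V y (vadd V x z)"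
  using assms by (metis add_assoc add_commute)

lemma scale_zero_left: "x \<in> vcarrier V \<Longrightarrow> vscale V 0 x = vzero V"
  using scale_add_left[of x 1 "-1"] add_inverse[of x] by (simp add: scale_one vdiff_def)

lemma scale_zero_right: "vscale V a (vzero V) = vzero V"
  using scale_scale[OF zero_closed, of a 0] scale_zero_left[OF zero_closed] by simp

lemma add_uminus_cancel:
  assumes "x \<in> vcarrier V" "y \<in> vcarrier V"
  shows "vadd V y (vadd V (vscale V (-1) y) x) = x"
  using assms add_assoc[of y "vscale V (-1) y" x] add_inverse[of y]
  by (simp add: scale_closed zero_add vdiff_def)

lemma add_diff_self:
  assumes "x \<in> vcarrier V" "y \<in> vcarrier V"
  shows "vadd V y (vdiff V x y) = x"
  using add_uminus_cancel[OF assms] assms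
  by (simp add: vdiff_def add_commute[of x "vscale V (-1) y"] scale_closed)

lemma diff_zero: "x \<in> vcarrier V \<Longrightarrow> vdiff V x (vzero V) = x"
  by (simp add: vdiff_def scale_zero_right add_zero)

lemma diff_add_add:
  assumes "x \<in> vcarrier V" "y \<in> vcarrier V" "z \<in> vcarrier V" "w \<in> vcarrier V"
  shows "vdiff V (vadd V x y) (vadd V z w) = vadd V (vdiff V x z) (vdiff V y w)"
  using assms
  by (simp add: vdiff_def scale_add_right add_assoc add_closed scale_closed
      add_left_commute[of "vscale V (-1) z" y])

lemma diff_scale:
  assumes "x \<in> vcarrier V" "y \<in> vcarrier V"
  shows "vdiff V (vscale V a x) (vscale V a y) = vscale V a (vdiff V x y)"
  using assms by (simp add: vdiff_def scale_add_right scale_scale scale_closed mult.commute)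

lemma norm_zero: "vnorm V (vzero V) = 0"
  using norm_eq_zero[OF zero_closed] by simp

lemma norm_uminus: "x \<in> vcarrier V \<Longrightarrow> vnorm V (vscale V (-1) x) = vnorm V x"
  by (simp add: norm_scale)

lemma norm_diff_le:
  "\<lbrakk>x \<in> vcarrier V; y \<in> vcarrier V\<rbrakk> \<Longrightarrow> vnorm V (vdiff V x y) \<le> vnorm V x + vnorm V y"
  using norm_triangle[of x "vscale V (-1) y"] by (simp add: vdiff_def scale_closed norm_uminus)

lemma vdist_eq: "\<lbrakk>x \<in> vcarrier V; y \<in> vcarrier V\<rbrakk> \<Longrightarrow> vdist V x y = vnorm V (vdiff V x y)"
  by (simp add: vdist_def)

lemma vdist_zero: "x \<in> vcarrier V \<Longrightarrow> vdist V x (vzero V) = vnorm V x"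
  by (simp add: vdist_eq zero_closed diff_zero)

sublocale metric: Metric_space "vcarrier V" "vdist V"
  by (rule vdist_metric)

lemma topspace_vtop: "topspace (vtop V) = vcarrier V"
  by (simp add: vtop_def)

lemma in_closure_iff:
  "S \<subseteq> vcarrier V \<Longrightarrow>
    x \<in> vtop V closure_of S \<longleftrightarrow> x \<in> vcarrier V \<and> (\<forall>e>0. \<exists>y\<in>S. vdist V x y < e)"
  unfolding vtop_def metric.metric_closure_of 
  by (auto simp: subset_iff)

lemma subspace_diff_closed:
  "\<lbrakk>linear_subspace V S; x \<in> S; y \<in> S\<rbrakk> \<Longrightarrow> vdiff V x y \<in> S"
  by (auto simp: linear_subspace_def vdiff_def)

end

lemma banach_spaceI:
  fixes V :: "'a nspace"
  assumes V: "normed_space V"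
    and lim: "\<And>s :: nat \<Rightarrow> 'a. \<lbrakk>\<And>n. s n \<in> vcarrier V;
        \<And>e. e > 0 \<Longrightarrow> \<exists>N. \<forall>m\<ge>N. \<forall>n\<ge>N. vdist V (s m) (s n) < e\<rbrakk>
      \<Longrightarrow> \<exists>x\<in>vcarrier V. \<forall>e>0. \<exists>N. \<forall>n\<ge>N. vdist V (s n) x < e"
  shows "banach_space V"
proof -
  interpret normed_space V by fact
  have "metric.mcomplete"
    unfolding metric.mcomplete_def
  proof (intro allI impI)
    fix s assume s: "metric.MCauchy s"
    then have sV: "s n \<in> vcarrier V" for n by (auto simp: metric.MCauchy_def)
    obtain x where "x \<in> vcarrier V" "\<forall>e>0. \<exists>N. \<forall>n\<ge>N. vdist V (s n) x < e"
      using lim[of s] s sV by (fastforce simp: metric.MCauchy_def)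
    then show "\<exists>x. limitin metric.mtopology s x sequentially"
      using sV by (auto simp: metric.limit_metric_sequentially)
  qed
  then show ?thesis
    using V by (simp add: banach_space_def banach_space_axioms_def)
qed

lemma (in banach_space) Cauchy_limit:
  fixes s :: "nat \<Rightarrow> 'a"
  assumes s: "\<And>n. s n \<in> vcarrier V"
    and cau: "\<And>e. e > 0 \<Longrightarrow> \<exists>N. \<forall>m\<ge>N. \<forall>n\<ge>N. vdist V (s m) (s n) < e"
  obtains x where "x \<in> vcarrier V" "\<And>e. e > 0 \<Longrightarrow> \<exists>N. \<forall>n\<ge>N. vdist V (s n) x < e"
proof -
  have "metric.MCauchy s"
    using s cau unfolding metric.MCauchy_def by blast
  then obtain x where "limitin metric.mtopology s x sequentially"
    using complete unfolding metric.mcomplete_def by blast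
  then show thesis
    using that[of x] unfolding metric.limit_metric_sequentially by meson
qed

lemma real_space_simps [simp]:
  "vcarrier real_space = UNIV" "vzero real_space = 0" "vadd real_space = (+)"
  "vscale real_space = (*)" "vnorm real_space = abs"
  by (simp_all add: real_space_def)

lemma normed_space_real: "normed_space real_space"
  by unfold_locales (auto simp: vdiff_def algebra_simps abs_mult)

lemma vdist_real [simp]: "vdist real_space x y = \<bar>x - y\<bar>"
  by (simp add: vdist_def vdiff_def)


section \<open>Bounded operators and Lipschitz maps\<close>

lemma bounded_ops_linear: "T \<in> bounded_ops E F \<Longrightarrow> T \<in> linear_maps E F"
  by (simp add: bounded_ops_def)

lemma bounded_ops_closed: "T \<in> bounded_ops E F \<Longrightarrow> x \<in> vcarrier E \<Longrightarrow> T x \<in> vcarrier F"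
  by (blast intro: bounded_ops_linear linear_maps_closed)

lemma bounded_ops_extensional: "T \<in> bounded_ops E F \<Longrightarrow> T \<in> extensional (vcarrier E)"
  by (auto simp: bounded_ops_def linear_maps_def PiE_def)

lemma linear_maps_add:
  "\<lbrakk>T \<in> linear_maps E F; x \<in> vcarrier E; y \<in> vcarrier E\<rbrakk> \<Longrightarrow> T (vadd E x y) = vadd F (T x) (T y)"
  by (simp add: linear_maps_def)

lemma linear_maps_scale:
  "\<lbrakk>T \<in> linear_maps E F; x \<in> vcarrier E\<rbrakk> \<Longrightarrow> T (vscale E a x) = vscale F a (T x)"
  by (simp add: linear_maps_def)

lemma linear_maps_diff:
  "\<lbrakk>T \<in> linear_maps E F; x \<in> vcarrier E; y \<in> vcarrier E; normed_space E\<rbrakk>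
    \<Longrightarrow> T (vdiff E x y) = vdiff F (T x) (T y)"
  by (simp add: vdiff_def linear_maps_add linear_maps_scale normed_space.scale_closed)

lemma linear_maps_zero:
  assumes T: "T \<in> linear_maps E F" and E: "normed_space E" and F: "normed_space F"
  shows "T (vzero E) = vzero F"
  using linear_maps_scale[OF T normed_space.zero_closed[OF E], of 0]
    linear_maps_closed[OF T normed_space.zero_closed[OF E]]
  by (simp add: normed_space.scale_zero_left[OF F] normed_space.scale_zero_right[OF E])

lemma bounded_ops_bound:
  assumes T: "T \<in> bounded_ops E F" and E: "normed_space E"
  obtains K where "K \<ge> 0" "\<And>x. x \<in> vcarrier E \<Longrightarrow> vnorm F (T x) \<le> K * vnorm E x"
proof -
  obtain K where K: "\<And>x. x \<in> vcarrier E \<Longrightarrow> vnorm F (T x) \<le> K * vnorm E x"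
    using T by (auto simp: bounded_ops_def)
  have "vnorm F (T x) \<le> \<bar>K\<bar> * vnorm E x" if "x \<in> vcarrier E" for x
    using K[OF that] mult_right_mono[OF abs_ge_self normed_space.norm_nonneg[OF E that], of K]
    by linarith
  then show thesis using that[of "\<bar>K\<bar>"] by simp
qed

lemma bounded_ops_vdist:
  assumes T: "T \<in> bounded_ops E F" and E: "normed_space E" and F: "normed_space F"
    and K: "\<And>x. x \<in> vcarrier E \<Longrightarrow> vnorm F (T x) \<le> K * vnorm E x"
    and xy: "x \<in> vcarrier E" "y \<in> vcarrier E"
  shows "vdist F (T x) (T y) \<le> K * vdist E x y"
  using K[OF normed_space.diff_closed[OF E xy]] bounded_ops_closed[OF T] xy
  by (simp add: linear_maps_diff[OF bounded_ops_linear[OF T] xy E]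
      normed_space.vdist_eq[OF E] normed_space.vdist_eq[OF F])

lemma bounded_ops_Lip0:
  assumes T: "T \<in> bounded_ops E F" and E: "normed_space E" and F: "normed_space F"
  shows "T \<in> Lip0 E F"
proof -
  obtain K where K: "\<And>x. x \<in> vcarrier E \<Longrightarrow> vnorm F (T x) \<le> K * vnorm E x"
    using bounded_ops_bound[OF T E] by blast
  show ?thesis
    using bounded_ops_vdist[OF T E F K] linear_maps_zero[OF bounded_ops_linear[OF T] E F] T
    unfolding Lip0_def bounded_ops_def linear_maps_def by blast
qed

lemma Lip0_closed: "f \<in> Lip0 X Y \<Longrightarrow> x \<in> vcarrier X \<Longrightarrow> f x \<in> vcarrier Y"
  by (auto simp: Lip0_def)

lemma Lip0_extensional: "f \<in> Lip0 X Y \<Longrightarrow> f \<in> extensional (vcarrier X)"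
  by (auto simp: Lip0_def PiE_def)

lemma Lip0_zero: "f \<in> Lip0 X Y \<Longrightarrow> f (vzero X) = vzero Y"
  by (simp add: Lip0_def)

lemma Lip0I:
  assumes "\<And>x. x \<in> vcarrier X \<Longrightarrow> f x \<in> vcarrier Y" "f \<in> extensional (vcarrier X)"
    "f (vzero X) = vzero Y"
    "\<And>x y. \<lbrakk>x \<in> vcarrier X; y \<in> vcarrier X\<rbrakk> \<Longrightarrow> vdist Y (f x) (f y) \<le> K * vdist X x y"
  shows "f \<in> Lip0 X Y"
  using assms unfolding Lip0_def PiE_def by blast

lemma lip_norm_bound:
  assumes f: "f \<in> Lip0 X Y" and X: "normed_space X" and Y: "normed_space Y"
    and xy: "x \<in> vcarrier X" "y \<in> vcarrier X"
  shows "vdist Y (f x) (f y) \<le> lip_norm X Y f * vdist X x y"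
proof -
  interpret X: normed_space X by fact
  interpret Y: normed_space Y by fact
  obtain K where K: "\<And>x y. \<lbrakk>x \<in> vcarrier X; y \<in> vcarrier X\<rbrakk> \<Longrightarrow> vdist Y (f x) (f y) \<le> K * vdist X x y"
    using f by (auto simp: Lip0_def)
  let ?S = "{vdist Y (f x) (f y) / vdist X x y | x y. x \<in> vcarrier X \<and> y \<in> vcarrier X \<and> x \<noteq> y}"
  have pos: "vdist X x y > 0" if "x \<in> vcarrier X" "y \<in> vcarrier X" "x \<noteq> y" for x y
    using that X.metric.mdist_pos_less by blast
  have "bdd_above (insert 0 ?S)"
    unfolding bdd_above_insert
  proof (rule bdd_aboveI)
    fix r assume "r \<in> ?S"
    then obtain x y where "x \<in> vcarrier X" "y \<in> vcarrier X" "x \<noteq> y"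
      "r = vdist Y (f x) (f y) / vdist X x y" by blast
    then show "r \<le> K" using K[of x y] pos[of x y] by (simp add: pos_divide_le_eq)
  qed
  then have up: "r \<le> lip_norm X Y f" if "r \<in> ?S" for r
    unfolding lip_norm_def using that by (intro cSup_upper) auto
  show ?thesis
  proof (cases "x = y")
    case True
    then show ?thesis using f xy by (simp add: Lip0_closed)
  next
    case False
    have "vdist Y (f x) (f y) / vdist X x y \<le> lip_norm X Y f"
      using xy False by (intro up) blast
    then show ?thesis using pos[OF xy False] by (simp add: pos_divide_le_eq)
  qed
qed

lemma lip_norm_le:
  assumes X: "normed_space X" and K: "K \<ge> 0"
    and le: "\<And>x y. \<lbrakk>x \<in> vcarrier X; y \<in> vcarrier X\<rbrakk> \<Longrightarrow> vdist Y (f x) (f y) \<le> K * vdist X x y"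
  shows "lip_norm X Y f \<le> K"
proof -
  interpret X: normed_space X by fact
  show ?thesis
    unfolding lip_norm_def
  proof (rule cSup_least)
    fix r assume "r \<in> insert 0 {vdist Y (f x) (f y) / vdist X x y | x y.
      x \<in> vcarrier X \<and> y \<in> vcarrier X \<and> x \<noteq> y}"
    then consider "r = 0" | x y where "x \<in> vcarrier X" "y \<in> vcarrier X" "x \<noteq> y"
      "r = vdist Y (f x) (f y) / vdist X x y" by blast
    then show "r \<le> K"
    proof cases
      case 2
      then have "vdist X x y > 0" using X.metric.mdist_pos_less by blast
      then show ?thesis using le[of x y] 2 by (simp add: pos_divide_le_eq)
    qed (use K in simp)
  qed simp
qed

lemma lip_norm_nonneg:
  assumes f: "f \<in> Lip0 X Y" and X: "normed_space X" and Y: "normed_space Y"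
  shows "0 \<le> lip_norm X Y f"
proof (cases "\<exists>x\<in>vcarrier X. x \<noteq> vzero X")
  case True
  interpret X: normed_space X by fact
  interpret Y: normed_space Y by fact
  obtain x where x: "x \<in> vcarrier X" "x \<noteq> vzero X" using True by blast
  have "vdist X x (vzero X) > 0" using x X.metric.mdist_pos_less X.zero_closed by blast
  then show ?thesis
    using lip_norm_bound[OF f X Y x(1) X.zero_closed] Y.metric.nonneg[of "f x" "f (vzero X)"]
      zero_le_mult_iff[of "lip_norm X Y f" "vdist X x (vzero X)"] by linarith
next
  case False
  then have "\<not> (x \<in> vcarrier X \<and> y \<in> vcarrier X \<and> x \<noteq> y)" for x y
    by metis
  then have empty: "{vdist Y (f x) (f y) / vdist X x y | x y.
      x \<in> vcarrier X \<and> y \<in> vcarrier X \<and> x \<noteq> y} = {}"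
    by blast
  show ?thesis unfolding lip_norm_def empty by simp
qed

lemma Lip0_continuous:
  assumes f: "f \<in> Lip0 X Y" and X: "normed_space X" and Y: "normed_space Y"
  shows "continuous_map (vtop X) (vtop Y) f"
proof -
  interpret X: normed_space X by fact
  interpret Y: normed_space Y by fact
  obtain K where K: "K \<ge> 0" "\<And>x y. \<lbrakk>x \<in> vcarrier X; y \<in> vcarrier X\<rbrakk> \<Longrightarrow> vdist Y (f x) (f y) \<le> K * vdist X x y"
    using lip_norm_bound[OF f X Y] lip_norm_nonneg[OF f X Y] by blast
  show ?thesis
    unfolding vtop_def X.metric.metric_continuous_map[OF Y.vdist_metric]
  proof (intro conjI ballI allI impI)
    show "f ` vcarrier X \<subseteq> vcarrier Y" using f by (auto simp: Lip0_closed)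
    fix a and e :: real assume a: "a \<in> vcarrier X" and e: "e > 0"
    have "vdist Y (f a) (f x) < e" if "x \<in> vcarrier X" "vdist X a x < e / (K + 1)" for x
    proof -
      have "(K + 1) * vdist X a x < e" using that K(1) by (simp add: field_simps)
      then have "K * vdist X a x < e" using X.metric.nonneg[of a x] unfolding distrib_right mult_1_left by linarith
      then show ?thesis using K(2)[OF a that(1)] by linarith
    qed
    then show "\<exists>d>0. \<forall>x. x \<in> vcarrier X \<and> vdist X a x < d \<longrightarrow> vdist Y (f a) (f x) < e"
      using e K(1) by (intro exI[of _ "e / (K + 1)"]) auto
  qed
qed

lemma Lip0_compose:
  assumes f: "f \<in> Lip0 X Y" and g: "g \<in> Lip0 Y Z"
    and X: "normed_space X" and Y: "normed_space Y" and Z: "normed_space Z"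
  shows "compose (vcarrier X) g f \<in> Lip0 X Z"
    and "lip_norm X Z (compose (vcarrier X) g f) \<le> lip_norm Y Z g * lip_norm X Y f"
proof -
  let ?K = "lip_norm Y Z g * lip_norm X Y f"
  have le: "vdist Z (compose (vcarrier X) g f x) (compose (vcarrier X) g f y) \<le> ?K * vdist X x y"
    if "x \<in> vcarrier X" "y \<in> vcarrier X" for x y
  proof -
    have "vdist Z (g (f x)) (g (f y)) \<le> lip_norm Y Z g * vdist Y (f x) (f y)"
      by (rule lip_norm_bound[OF g Y Z Lip0_closed[OF f that(1)] Lip0_closed[OF f that(2)]])
    also have "\<dots> \<le> lip_norm Y Z g * (lip_norm X Y f * vdist X x y)"
      by (rule mult_left_mono[OF lip_norm_bound[OF f X Y that] lip_norm_nonneg[OF g Y Z]])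
    finally show ?thesis using that by (simp add: compose_def mult.assoc)
  qed
  show "compose (vcarrier X) g f \<in> Lip0 X Z"
    using le Lip0_closed[OF g Lip0_closed[OF f]]
    by (intro Lip0I[where K = ?K])
      (auto simp: Lip0_zero[OF f] Lip0_zero[OF g] compose_def normed_space.zero_closed[OF X])
  show "lip_norm X Z (compose (vcarrier X) g f) \<le> ?K"
    by (rule lip_norm_le[OF X mult_nonneg_nonneg[OF lip_norm_nonneg[OF g Y Z] lip_norm_nonneg[OF f X Y]] le])
qed


section \<open>The Hahn--Banach theorem: norming functionals\<close>

text \<open>
  Positive homogeneity is required only as an inequality: applying it to \<open>1/a\<close> gives the reverse one.
  Functions are extensional so that mutually dominating functionals are equal.
\<close>

definition (in normed_space) sublinear_minorants :: "('a \<Rightarrow> real) set" where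
  "sublinear_minorants = {p \<in> extensional (vcarrier V).
     (\<forall>x\<in>vcarrier V. \<forall>y\<in>vcarrier V. p (vadd V x y) \<le> p x + p y) \<and>
     (\<forall>a>0. \<forall>x\<in>vcarrier V. p (vscale V a x) \<le> a * p x) \<and>
     (\<forall>x\<in>vcarrier V. p x \<le> vnorm V x)}"

context normed_space
begin

lemma sublinear_minorantsD:
  assumes "p \<in> sublinear_minorants"
  shows "\<And>x y. \<lbrakk>x \<in> vcarrier V; y \<in> vcarrier V\<rbrakk> \<Longrightarrow> p (vadd V x y) \<le> p x + p y"
    and "\<And>a x. \<lbrakk>a > 0; x \<in> vcarrier V\<rbrakk> \<Longrightarrow> p (vscale V a x) = a * p x"
    and "\<And>x. x \<in> vcarrier V \<Longrightarrow> p x \<le> vnorm V x"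
    and "p (vzero V) = 0"
    and "\<And>x. x \<in> vcarrier V \<Longrightarrow> - vnorm V x \<le> p x"
    and "\<And>x. x \<in> vcarrier V \<Longrightarrow> 0 \<le> p x + p (vscale V (-1) x)"
    and "p \<in> extensional (vcarrier V)"
proof -
  have p: "p \<in> extensional (vcarrier V)"
    "\<And>x y. \<lbrakk>x \<in> vcarrier V; y \<in> vcarrier V\<rbrakk> \<Longrightarrow> p (vadd V x y) \<le> p x + p y"
    "\<And>a x. \<lbrakk>a > 0; x \<in> vcarrier V\<rbrakk> \<Longrightarrow> p (vscale V a x) \<le> a * p x"
    "\<And>x. x \<in> vcarrier V \<Longrightarrow> p x \<le> vnorm V x"
    using assms unfolding sublinear_minorants_def by blast+
  have hom: "p (vscale V a x) = a * p x" if "a > 0" "x \<in> vcarrier V" for a x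
  proof -
    have "p x \<le> inverse a * p (vscale V a x)"
      using p(3)[of "inverse a" "vscale V a x"] that by (simp add: scale_scale scale_one scale_closed)
    then show ?thesis using p(3)[OF that] that by (simp add: field_simps)
  qed
  have z: "p (vzero V) = 0"
    using hom[of 2 "vzero V"] by (simp add: scale_zero_right zero_closed)
  have sym: "0 \<le> p x + p (vscale V (-1) x)" if "x \<in> vcarrier V" for x
    using p(2)[OF that scale_closed[OF that, of "-1"]] add_inverse[OF that] z by (simp add: vdiff_def)
  have "- vnorm V x \<le> p x" if "x \<in> vcarrier V" for x
    using sym[OF that] p(4)[OF scale_closed[OF that, of "-1"]] norm_uminus[OF that] by linarith
  then show "\<And>x y. \<lbrakk>x \<in> vcarrier V; y \<in> vcarrier V\<rbrakk> \<Longrightarrow> p (vadd V x y) \<le> p x + p y"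
    and "\<And>a x. \<lbrakk>a > 0; x \<in> vcarrier V\<rbrakk> \<Longrightarrow> p (vscale V a x) = a * p x"
    and "\<And>x. x \<in> vcarrier V \<Longrightarrow> p x \<le> vnorm V x"
    and "p (vzero V) = 0"
    and "\<And>x. x \<in> vcarrier V \<Longrightarrow> - vnorm V x \<le> p x"
    and "\<And>x. x \<in> vcarrier V \<Longrightarrow> 0 \<le> p x + p (vscale V (-1) x)"
    and "p \<in> extensional (vcarrier V)"
    using p hom z sym by blast+
qed

lemma norm_sublinear: "(\<lambda>x\<in>vcarrier V. vnorm V x) \<in> sublinear_minorants"
  by (auto simp: sublinear_minorants_def add_closed scale_closed norm_triangle norm_scale)

text \<open>
  The functional \<open>q(x) = inf {p(x + t y) - t p(y) | t \<ge> 0}\<close> is sublinear, lies below \<open>p\<close> (take \<open>t = 0\<close>)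
  and satisfies \<open>q(-y) \<le> -p(y)\<close> (take \<open>t = 1\<close>).  It serves twice: to make a functional norming at
  \<open>y\<close>, and to show that a functional which cannot be lowered any more is odd.
\<close>

lemma sublinear_tilt:
  assumes p: "p \<in> sublinear_minorants" and y: "y \<in> vcarrier V"
  obtains q where "q \<in> sublinear_minorants" "\<And>x. x \<in> vcarrier V \<Longrightarrow> q x \<le> p x"
    "q (vscale V (-1) y) \<le> - p y"
proof -
  note pD = sublinear_minorantsD[OF p]
  let ?g = "\<lambda>x t. p (vadd V x (vscale V t y)) - t * p y"
  let ?q = "\<lambda>x\<in>vcarrier V. INF t\<in>{0..}. ?g x t"
  have lb: "- p (vscale V (-1) x) \<le> ?g x t" if x: "x \<in> vcarrier V" and t: "t \<ge> 0" for x t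
  proof -
    have "t * p y = p (vscale V t y)"
      using t y pD(2)[of t y] pD(4) by (cases "t = 0") (auto simp: scale_zero_left)
    also have "vscale V t y = vadd V (vadd V x (vscale V t y)) (vscale V (-1) x)"
      using x y add_uminus_cancel[of "vscale V t y" x]
      by (metis add_assoc add_closed add_commute scale_closed)
    also have "p \<dots> \<le> p (vadd V x (vscale V t y)) + p (vscale V (-1) x)"
      using x y by (intro pD(1) add_closed scale_closed)
    finally show ?thesis by simp
  qed
  have bdd: "bdd_below (?g x ` {0..})" if "x \<in> vcarrier V" for x
    using lb[OF that] by (intro bdd_belowI[of _ "- p (vscale V (-1) x)"]) auto
  have up: "?q x \<le> ?g x t" if "x \<in> vcarrier V" "t \<ge> 0" for x t
    using that bdd[OF that(1)] by (auto intro!: cINF_lower)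
  have gr: "r \<le> ?q x" if "x \<in> vcarrier V" "\<And>t. t \<ge> 0 \<Longrightarrow> r \<le> ?g x t" for x r
    using that by (auto intro!: cINF_greatest)
  have le: "?q x \<le> p x" if "x \<in> vcarrier V" for x
    using up[OF that, of 0] that y by (simp add: scale_zero_left add_zero)
  have "?q (vadd V x z) \<le> ?q x + ?q z" if xz: "x \<in> vcarrier V" "z \<in> vcarrier V" for x z
  proof -
    have "?q (vadd V x z) - ?g z t \<le> ?g x s" if st: "s \<ge> 0" "t \<ge> 0" for s t
    proof -
      have eq: "vadd V (vadd V x z) (vscale V (s + t) y)
          = vadd V (vadd V x (vscale V s y)) (vadd V z (vscale V t y))"
        using xz y
        by (simp add: scale_add_left add_assoc add_closed scale_closed
            add_left_commute[of z "vscale V s y"])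
      have "?q (vadd V x z) \<le> ?g (vadd V x z) (s + t)"
        using xz st by (intro up add_closed) auto
      also have "\<dots> \<le> ?g x s + ?g z t"
        unfolding eq using xz y pD(1)[of "vadd V x (vscale V s y)" "vadd V z (vscale V t y)"]
        by (simp add: add_closed scale_closed algebra_simps)
      finally show ?thesis by simp
    qed
    then have "?q (vadd V x z) - ?g z t \<le> ?q x" if "t \<ge> 0" for t
      using that by (intro gr xz) auto
    then have "?q (vadd V x z) - ?q x \<le> ?g z t" if "t \<ge> 0" for t
      using that by (simp add: algebra_simps)
    then have "?q (vadd V x z) - ?q x \<le> ?q z"
      by (intro gr xz) auto
    then show ?thesis by simp
  qed
  moreover have "?q (vscale V a x) \<le> a * ?q x" if a: "a > 0" and x: "x \<in> vcarrier V" for a x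
  proof -
    have "inverse a * ?q (vscale V a x) \<le> ?g x t" if t: "t \<ge> 0" for t
    proof -
      have "?q (vscale V a x) \<le> ?g (vscale V a x) (a * t)"
        using a x t by (intro up scale_closed) auto
      also have "vadd V (vscale V a x) (vscale V (a * t) y) = vscale V a (vadd V x (vscale V t y))"
        using x y by (simp add: scale_add_right scale_scale scale_closed)
      also have "p \<dots> = a * p (vadd V x (vscale V t y))"
        using x y a by (intro pD(2) add_closed scale_closed)
      finally have "?q (vscale V a x) \<le> a * ?g x t" by (simp add: algebra_simps)
      then show ?thesis using a by (simp add: field_simps)
    qed
    then have "inverse a * ?q (vscale V a x) \<le> ?q x" by (rule gr[OF x])
    then show ?thesis using a by (simp add: field_simps)
  qed
  ultimately have "?q \<in> sublinear_minorants"
    using le pD(3) unfolding sublinear_minorants_def by (force intro: order_trans)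
  moreover have "?q (vscale V (-1) y) \<le> - p y"
    using up[OF scale_closed[OF y], of 1 "-1"] y add_inverse[OF y] pD(4)
    by (simp add: scale_one add_commute[of "vscale V (-1) y" y] scale_closed vdiff_def)
  ultimately show thesis using that[of ?q] le by blast
qed

text \<open>
  Zorn's lemma for the reversed pointwise order.  The infimum of a chain is bounded below by \<open>-\<parallel>x\<parallel>\<close>;
  it is subadditive because of two members of a chain one lies below the other.
\<close>

lemma minimal_sublinear_below:
  assumes q: "q \<in> sublinear_minorants"
  obtains m where "m \<in> sublinear_minorants" "\<And>x. x \<in> vcarrier V \<Longrightarrow> m x \<le> q x"
    "\<And>p. \<lbrakk>p \<in> sublinear_minorants; \<And>x. x \<in> vcarrier V \<Longrightarrow> p x \<le> m x\<rbrakk> \<Longrightarrow> p = m"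
proof -
  define S where "S = {p \<in> sublinear_minorants. \<forall>x\<in>vcarrier V. p x \<le> q x}"
  define P where "P = (\<lambda>p r. \<forall>x\<in>vcarrier V. (r x :: real) \<le> p x)"
  have anti: "p = r" if "p \<in> S" "r \<in> S" "P p r" "P r p" for p r
  proof (rule extensionalityI)
    show "p \<in> extensional (vcarrier V)" "r \<in> extensional (vcarrier V)"
      using that by (auto simp: S_def sublinear_minorants_def)
    show "p x = r x" if "x \<in> vcarrier V" for x
      using that \<open>P p r\<close> \<open>P r p\<close> by (auto simp: P_def intro: antisym)
  qed
  have "\<exists>m\<in>S. \<forall>a\<in>S. P m a \<longrightarrow> a = m"
  proof (rule predicate_Zorn)
    show "partial_order_on S (relation_of P S)"
      by (rule partial_order_on_relation_ofI) (use anti in \<open>auto simp: P_def intro: order_trans\<close>)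
    fix C assume C: "C \<in> Chains (relation_of P S)"
    show "\<exists>u\<in>S. \<forall>a\<in>C. P a u"
    proof (cases "C = {}")
      case True
      then show ?thesis using q by (auto simp: S_def)
    next
      case False
      have CS: "C \<subseteq> S" and tot: "\<And>p r. \<lbrakk>p \<in> C; r \<in> C\<rbrakk> \<Longrightarrow> P p r \<or> P r p"
        using C by (auto simp: Chains_def relation_of_def)
      have D: "p \<in> sublinear_minorants" if "p \<in> C" for p using CS that by (auto simp: S_def)
      let ?u = "\<lambda>x\<in>vcarrier V. INF p\<in>C. p x"
      have bdd: "bdd_below ((\<lambda>p. p x) ` C)" if "x \<in> vcarrier V" for x
        using sublinear_minorantsD(5)[OF D that] by (intro bdd_belowI[of _ "- vnorm V x"]) auto
      have up: "?u x \<le> p x" if "x \<in> vcarrier V" "p \<in> C" for x p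
        using that bdd[OF that(1)] by (auto intro!: cINF_lower)
      have gr: "r \<le> ?u x" if "x \<in> vcarrier V" "\<And>p. p \<in> C \<Longrightarrow> r \<le> p x" for x r
        using that False by (auto intro!: cINF_greatest)
      have add: "?u (vadd V x y) \<le> ?u x + ?u y" if xy: "x \<in> vcarrier V" "y \<in> vcarrier V" for x y
      proof -
        have *: "?u (vadd V x y) - p x \<le> r y" if pr: "p \<in> C" "r \<in> C" for p r
        proof -
          obtain s where s: "s \<in> C" "s x \<le> p x" "s y \<le> r y"
            using tot[OF pr] pr xy unfolding P_def by (metis order_refl)
          have "?u (vadd V x y) \<le> s (vadd V x y)" using xy s by (intro up add_closed)
          also have "\<dots> \<le> s x + s y" using D[OF s(1)] xy by (rule sublinear_minorantsD(1))
          finally show ?thesis using s by linarith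
        qed
        have "?u (vadd V x y) - p x \<le> ?u y" if "p \<in> C" for p
          using that by (intro gr xy *)
        then have "?u (vadd V x y) - ?u y \<le> ?u x"
          by (intro gr xy) (auto simp: algebra_simps)
        then show ?thesis by simp
      qed
      have sc: "?u (vscale V a x) \<le> a * ?u x" if a: "a > 0" and x: "x \<in> vcarrier V" for a x
      proof -
        have "inverse a * ?u (vscale V a x) \<le> ?u x"
        proof (rule gr[OF x])
          fix p assume p: "p \<in> C"
          show "inverse a * ?u (vscale V a x) \<le> p x"
            using up[OF scale_closed[OF x] p, of a] sublinear_minorantsD(2)[OF D[OF p] a x] a
            by (simp add: field_simps)
        qed
        then show ?thesis using a by (simp add: field_simps)
      qed
      have leq: "?u x \<le> q x" "?u x \<le> vnorm V x" if x: "x \<in> vcarrier V" for x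
      proof -
        obtain p where p: "p \<in> C" using False by blast
        then have "p x \<le> q x" "p x \<le> vnorm V x"
          using CS x sublinear_minorantsD(3)[OF D[OF p] x] by (auto simp: S_def)
        then show "?u x \<le> q x" "?u x \<le> vnorm V x" using up[OF x p] by linarith+
      qed
      have "?u \<in> S" using add sc leq by (auto simp: S_def sublinear_minorants_def)
      moreover have "P p ?u" if "p \<in> C" for p using up that by (auto simp: P_def)
      ultimately show ?thesis by blast
    qed
  qed
  then obtain m where m: "m \<in> S" "\<And>a. \<lbrakk>a \<in> S; P m a\<rbrakk> \<Longrightarrow> a = m" by blast
  show thesis
  proof (rule that[of m])
    show "m \<in> sublinear_minorants" "\<And>x. x \<in> vcarrier V \<Longrightarrow> m x \<le> q x"
      using m(1) by (auto simp: S_def)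
    fix p assume p: "p \<in> sublinear_minorants" "\<And>x. x \<in> vcarrier V \<Longrightarrow> p x \<le> m x"
    then have "p \<in> S" using m(1) by (force simp: S_def intro: order_trans)
    then show "p = m" using m(2) p(2) by (auto simp: P_def)
  qed
qed

text \<open>
  A minimal \<open>m\<close> equals each of its tilts, hence \<open>m(-y) \<le> -m(y)\<close> for all \<open>y\<close>.  An odd sublinear
  functional is additive, since subadditivity at \<open>-x, -y\<close> is superadditivity at \<open>x, y\<close>.
\<close>

lemma minimal_sublinear_linear:
  assumes m: "m \<in> sublinear_minorants"
    and min: "\<And>p. \<lbrakk>p \<in> sublinear_minorants; \<And>x. x \<in> vcarrier V \<Longrightarrow> p x \<le> m x\<rbrakk> \<Longrightarrow> p = m"
  shows "m \<in> linear_maps V real_space"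
proof -
  note mD = sublinear_minorantsD[OF m]
  have neg: "m (vscale V (-1) y) = - m y" if y: "y \<in> vcarrier V" for y
  proof -
    obtain q where "q \<in> sublinear_minorants" "\<And>x. x \<in> vcarrier V \<Longrightarrow> q x \<le> m x"
      "q (vscale V (-1) y) \<le> - m y"
      using sublinear_tilt[OF m y] by blast
    then have "m (vscale V (-1) y) \<le> - m y" using min by metis
    then show ?thesis using mD(6)[OF y] by linarith
  qed
  have add: "m (vadd V x y) = m x + m y" if xy: "x \<in> vcarrier V" "y \<in> vcarrier V" for x y
  proof -
    have "m (vscale V (-1) (vadd V x y)) \<le> m (vscale V (-1) x) + m (vscale V (-1) y)"
      using xy mD(1)[OF scale_closed scale_closed, of x y "-1" "-1"] by (simp add: scale_add_right)
    then show ?thesis using mD(1)[OF xy] neg xy by (simp add: add_closed)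
  qed
  have "m (vscale V a x) = a * m x" if x: "x \<in> vcarrier V" for a x
  proof -
    consider "a > 0" | "a = 0" | "a < 0" by linarith
    then show ?thesis
    proof cases
      case 3
      then have "m (vscale V (- a) x) = - a * m x" using mD(2)[of "- a" x] x by simp
      then show ?thesis
        using neg[OF scale_closed[OF x, of "- a"]] x by (simp add: scale_scale)
    qed (use x mD in \<open>auto simp: scale_zero_left\<close>)
  qed
  then show ?thesis
    using add mD(7) by (auto simp: linear_maps_def PiE_def)
qed

text \<open>
  Tilting the norm towards \<open>y\<close> gives a sublinear functional with value at most \<open>-\<parallel>y\<parallel>\<close> at \<open>-y\<close>.  A
  minimal functional below it is linear, so its value at \<open>y\<close> is at least \<open>\<parallel>y\<parallel>\<close>.
\<close>

theorem norming_functional: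
  assumes y: "y \<in> vcarrier V"
  shows "\<exists>f\<in>linear_maps V real_space. (\<forall>x\<in>vcarrier V. \<bar>f x\<bar> \<le> vnorm V x) \<and> f y = vnorm V y"
proof -
  obtain q where q: "q \<in> sublinear_minorants" "q (vscale V (-1) y) \<le> - vnorm V y"
    using sublinear_tilt[OF norm_sublinear y] y by (metis restrict_apply')
  obtain f where f: "f \<in> sublinear_minorants" "\<And>x. x \<in> vcarrier V \<Longrightarrow> f x \<le> q x"
    "\<And>p. \<lbrakk>p \<in> sublinear_minorants; \<And>x. x \<in> vcarrier V \<Longrightarrow> p x \<le> f x\<rbrakk> \<Longrightarrow> p = f"
    using minimal_sublinear_below[OF q(1)] by blast
  note fD = sublinear_minorantsD[OF f(1)]
  have lin: "f \<in> linear_maps V real_space"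
    using minimal_sublinear_linear[OF f(1)] f(3) by blast
  have "f y = - f (vscale V (-1) y)"
    using linear_maps_scale[OF lin y, of "-1"] by simp
  then have "f y = vnorm V y"
    using f(2)[OF scale_closed[OF y, of "-1"]] q(2) fD(3)[OF y] by linarith
  moreover have "\<bar>f x\<bar> \<le> vnorm V x" if "x \<in> vcarrier V" for x
    using fD(3)[OF that] fD(5)[OF that] by linarith
  ultimately show ?thesis using lin by blast
qed

end


section \<open>Spaces of real functions and the dual space\<close>

lemma fun_ops_real:
  "fun_zero S real_space = (\<lambda>x\<in>S. 0)"
  "fun_add S real_space f g = (\<lambda>x\<in>S. f x + g x)"
  "fun_scale S real_space a f = (\<lambda>x\<in>S. a * f x)"
  by (simp_all add: fun_zero_def fun_add_def fun_scale_def)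

text \<open>
  The Lipschitz norm and the norm of a functional have the same shape: both are the least \<open>K \<ge> 0\<close>
  with \<open>\<bar>e\<^sub>i f\<bar> \<le> K w\<^sub>i\<close> for all \<open>i\<close>, where the \<open>e\<^sub>i\<close> are linear forms that separate points (differences
  \<open>f x - f y\<close> with weight \<open>\<parallel>x - y\<parallel>\<close> in the first case, values \<open>T x\<close> with weight \<open>\<parallel>x\<parallel>\<close> in the
  second).  The norm axioms follow from this description alone.
\<close>

lemma normed_space_of_least_bound:
  fixes W :: "('a \<Rightarrow> real) nspace" and e :: "'i \<Rightarrow> ('a \<Rightarrow> real) \<Rightarrow> real" and w :: "'i \<Rightarrow> real"
  assumes ops: "vzero W = fun_zero S real_space" "vadd W = fun_add S real_space"
      "vscale W = fun_scale S real_space"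
    and ext: "vcarrier W \<subseteq> extensional S"
    and zero: "vzero W \<in> vcarrier W"
    and add: "\<And>f g. \<lbrakk>f \<in> vcarrier W; g \<in> vcarrier W\<rbrakk> \<Longrightarrow> vadd W f g \<in> vcarrier W"
    and scale: "\<And>a f. f \<in> vcarrier W \<Longrightarrow> vscale W a f \<in> vcarrier W"
    and e_add: "\<And>i f g. \<lbrakk>i \<in> I; f \<in> vcarrier W; g \<in> vcarrier W\<rbrakk> \<Longrightarrow> e i (vadd W f g) = e i f + e i g"
    and e_scale: "\<And>i a f. \<lbrakk>i \<in> I; f \<in> vcarrier W\<rbrakk> \<Longrightarrow> e i (vscale W a f) = a * e i f"
    and sep: "\<And>f. \<lbrakk>f \<in> vcarrier W; \<And>i. i \<in> I \<Longrightarrow> e i f = 0\<rbrakk> \<Longrightarrow> f = vzero W"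
    and nonneg: "\<And>f. f \<in> vcarrier W \<Longrightarrow> 0 \<le> vnorm W f"
    and bound: "\<And>i f. \<lbrakk>i \<in> I; f \<in> vcarrier W\<rbrakk> \<Longrightarrow> \<bar>e i f\<bar> \<le> vnorm W f * w i"
    and least: "\<And>f K. \<lbrakk>f \<in> vcarrier W; K \<ge> 0; \<And>i. i \<in> I \<Longrightarrow> \<bar>e i f\<bar> \<le> K * w i\<rbrakk> \<Longrightarrow> vnorm W f \<le> K"
  shows "normed_space W"
proof -
  have ext': "f \<in> extensional S" if "f \<in> vcarrier W" for f using ext that by blast
  have cl: "(\<lambda>x\<in>S. f x + g x) \<in> vcarrier W" "(\<lambda>x\<in>S. a * f x) \<in> vcarrier W"
    if "f \<in> vcarrier W" "g \<in> vcarrier W" for f g a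
    using add[of f g] scale[of f a] that by (simp_all add: ops fun_ops_real)
  have scale0: "vscale W 0 f = vzero W" for f
    by (simp add: ops fun_ops_real)
  have norm0: "vnorm W (vzero W) = 0"
  proof -
    have "e i (vzero W) = 0" if "i \<in> I" for i
      using e_scale[OF that zero, of 0] by (simp add: scale0)
    then have "vnorm W (vzero W) \<le> 0" by (intro least[OF zero]) auto
    then show ?thesis using nonneg[OF zero] by simp
  qed
  have scale_le: "vnorm W (vscale W a f) \<le> \<bar>a\<bar> * vnorm W f" if f: "f \<in> vcarrier W" for a f
  proof (rule least[OF scale[OF f]])
    show "0 \<le> \<bar>a\<bar> * vnorm W f" using nonneg[OF f] by simp
    show "\<bar>e i (vscale W a f)\<bar> \<le> \<bar>a\<bar> * vnorm W f * w i" if "i \<in> I" for i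
      using mult_left_mono[OF bound[OF that f] abs_ge_zero[of a]] e_scale[OF that f, of a]
      by (simp add: abs_mult mult.assoc)
  qed
  show ?thesis
  proof
    show "vzero W \<in> vcarrier W" by (rule zero)
    show "vadd W f g \<in> vcarrier W" if "f \<in> vcarrier W" "g \<in> vcarrier W" for f g
      using that by (rule add)
    show "vscale W a f \<in> vcarrier W" if "f \<in> vcarrier W" for a f
      using that by (rule scale)
    show "vadd W (vadd W f g) h = vadd W f (vadd W g h)" for f g h
      by (auto simp: ops fun_ops_real add.assoc)
    show "vadd W f g = vadd W g f" for f g
      by (simp add: ops fun_ops_real add.commute)
    show "vadd W f (vzero W) = f" if "f \<in> vcarrier W" for f
      using ext'[OF that] by (intro extensionalityI[of _ S]) (auto simp: ops fun_ops_real)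
    show "vdiff W f f = vzero W" for f
      by (rule extensionalityI[of _ S]) (auto simp: vdiff_def ops fun_ops_real)
    show "vscale W a (vadd W f g) = vadd W (vscale W a f) (vscale W a g)" for a f g
      by (auto simp: ops fun_ops_real algebra_simps)
    show "vscale W (a + b) f = vadd W (vscale W a f) (vscale W b f)" for a b f
      by (auto simp: ops fun_ops_real algebra_simps)
    show "vscale W a (vscale W b f) = vscale W (a * b) f" for a b f
      by (auto simp: ops fun_ops_real algebra_simps)
    show "vscale W 1 f = f" if "f \<in> vcarrier W" for f
      using extensional_restrict[OF ext'[OF that]]
      by (simp add: ops fun_ops_real)
    show "0 \<le> vnorm W f" if "f \<in> vcarrier W" for f
      using that by (rule nonneg)
    show "vnorm W f = 0 \<longleftrightarrow> f = vzero W" if f: "f \<in> vcarrier W" for f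
    proof
      assume "vnorm W f = 0"
      then show "f = vzero W" using bound[OF _ f] by (intro sep[OF f]) auto
    qed (simp add: norm0)
    show "vnorm W (vscale W a f) = \<bar>a\<bar> * vnorm W f" if f: "f \<in> vcarrier W" for a f
    proof (cases "a = 0")
      case True
      then show ?thesis by (simp add: scale0 norm0)
    next
      case False
      have "vscale W (inverse a) (vscale W a f) = f"
        using ext'[OF f] False by (intro extensionalityI[of _ S]) (auto simp: ops fun_ops_real)
      then have "vnorm W f \<le> \<bar>inverse a\<bar> * vnorm W (vscale W a f)"
        using scale_le[OF scale[OF f, of a], of "inverse a"] by simp
      then have "\<bar>a\<bar> * vnorm W f \<le> vnorm W (vscale W a f)"
        using False by (simp add: field_simps)
      then show ?thesis using scale_le[OF f, of a] by linarith
    qed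
    show "vnorm W (vadd W f g) \<le> vnorm W f + vnorm W g" if fg: "f \<in> vcarrier W" "g \<in> vcarrier W" for f g
    proof (rule least[OF add[OF fg]])
      show "0 \<le> vnorm W f + vnorm W g" using nonneg[OF fg(1)] nonneg[OF fg(2)] by simp
      show "\<bar>e i (vadd W f g)\<bar> \<le> (vnorm W f + vnorm W g) * w i" if "i \<in> I" for i
        using bound[OF that fg(1)] bound[OF that fg(2)] e_add[OF that fg]
        unfolding distrib_right by linarith
    qed
  qed
qed

lemma Lip0_space_simps [simp]:
  "vcarrier (Lip0_space X Y) = Lip0 X Y"
  "vzero (Lip0_space X Y) = fun_zero (vcarrier X) Y"
  "vadd (Lip0_space X Y) = fun_add (vcarrier X) Y"
  "vscale (Lip0_space X Y) = fun_scale (vcarrier X) Y"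
  "vnorm (Lip0_space X Y) = lip_norm X Y"
  by (simp_all add: Lip0_space_def)

lemma dual_space_simps [simp]:
  "vcarrier (dual_space E) = bounded_ops E real_space"
  "vzero (dual_space E) = fun_zero (vcarrier E) real_space"
  "vadd (dual_space E) = fun_add (vcarrier E) real_space"
  "vscale (dual_space E) = fun_scale (vcarrier E) real_space"
  by (simp_all add: dual_space_def op_space_def)

lemma normed_space_Lip0:
  assumes X: "normed_space X"
  shows "normed_space (Lip0_space X real_space)"
proof -
  interpret X: normed_space X by fact
  let ?W = "Lip0_space X real_space"
  note bd = lip_norm_bound[OF _ X normed_space_real]
  show ?thesis
  proof (rule normed_space_of_least_bound[where S = "vcarrier X"
        and I = "vcarrier X \<times> vcarrier X" and e = "\<lambda>(x, y) f. f x - f y"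
        and w = "\<lambda>(x, y). vdist X x y"])
    show "vcarrier ?W \<subseteq> extensional (vcarrier X)" by (auto simp: Lip0_extensional)
    show "vzero ?W \<in> vcarrier ?W"
      by (auto intro!: Lip0I[where K = 0] simp: fun_ops_real X.zero_closed)
    show "vadd ?W f g \<in> vcarrier ?W" if fg: "f \<in> vcarrier ?W" "g \<in> vcarrier ?W" for f g
    proof -
      have "vdist real_space (f x + g x) (f y + g y)
          \<le> (lip_norm X real_space f + lip_norm X real_space g) * vdist X x y"
        if "x \<in> vcarrier X" "y \<in> vcarrier X" for x y
        using bd[of f x y] bd[of g x y] fg that unfolding distrib_right by simp
      then show ?thesis
        using fg by (auto intro!: Lip0I[where K = "lip_norm X real_space f + lip_norm X real_space g"]
            simp: fun_ops_real X.zero_closed Lip0_zero)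
    qed
    show "vscale ?W a f \<in> vcarrier ?W" if f: "f \<in> vcarrier ?W" for a f
    proof -
      have "vdist real_space (a * f x) (a * f y) \<le> \<bar>a\<bar> * lip_norm X real_space f * vdist X x y"
        if "x \<in> vcarrier X" "y \<in> vcarrier X" for x y
        using mult_left_mono[OF bd[of f x y] abs_ge_zero[of a]] f that
        by (simp add: abs_mult[symmetric] right_diff_distrib mult.assoc)
      then show ?thesis
        using f by (auto intro!: Lip0I[where K = "\<bar>a\<bar> * lip_norm X real_space f"]
            simp: fun_ops_real X.zero_closed Lip0_zero)
    qed
    show "f = vzero ?W"
      if f: "f \<in> vcarrier ?W"
        and z: "\<And>i. i \<in> vcarrier X \<times> vcarrier X \<Longrightarrow> (case i of (x, y) \<Rightarrow> \<lambda>f. f x - f y) f = 0" for f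
    proof (rule extensionalityI)
      show "f \<in> extensional (vcarrier X)" using f by (simp add: Lip0_extensional)
      show "vzero ?W \<in> extensional (vcarrier X)" by (simp add: fun_ops_real)
      show "f x = vzero ?W x" if "x \<in> vcarrier X" for x
        using z[of "(x, vzero X)"] that f X.zero_closed by (simp add: fun_ops_real Lip0_zero)
    qed
    show "0 \<le> vnorm ?W f" if "f \<in> vcarrier ?W" for f
      using that lip_norm_nonneg[OF _ X normed_space_real] by simp
    show "\<bar>(case i of (x, y) \<Rightarrow> \<lambda>f. f x - f y) f\<bar> \<le> vnorm ?W f * (case i of (x, y) \<Rightarrow> vdist X x y)"
      if "i \<in> vcarrier X \<times> vcarrier X" "f \<in> vcarrier ?W" for i f
      using that bd[of f] by auto
    show "vnorm ?W f \<le> K"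
      if "K \<ge> 0" and le: "\<And>i. i \<in> vcarrier X \<times> vcarrier X \<Longrightarrow>
        \<bar>(case i of (x, y) \<Rightarrow> \<lambda>f. f x - f y) f\<bar> \<le> K * (case i of (x, y) \<Rightarrow> vdist X x y)" for f K
      using le[of "(_, _)"] by (simp add: lip_norm_le[OF X \<open>K \<ge> 0\<close>])
  qed (auto simp: fun_ops_real algebra_simps)
qed

lemma dual_norm_bound:
  assumes E: "normed_space E" and T: "T \<in> bounded_ops E real_space" and x: "x \<in> vcarrier E"
  shows "\<bar>T x\<bar> \<le> vnorm (dual_space E) T * vnorm E x"
proof -
  interpret E: normed_space E by fact
  note lin = bounded_ops_linear[OF T]
  obtain K where K: "K \<ge> 0" "\<And>x. x \<in> vcarrier E \<Longrightarrow> \<bar>T x\<bar> \<le> K * vnorm E x"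
    using bounded_ops_bound[OF T E] by auto
  let ?B = "{x \<in> vcarrier E. vnorm E x \<le> 1}"
  have "bdd_above ((\<lambda>x. \<bar>T x\<bar>) ` ?B)"
  proof (rule bdd_aboveI2)
    show "\<bar>T x\<bar> \<le> K" if "x \<in> ?B" for x
      using K(2)[of x] mult_left_mono[of "vnorm E x" 1 K] that K(1) by simp
  qed
  then have up: "\<bar>T x\<bar> \<le> vnorm (dual_space E) T" if "x \<in> ?B" for x
    using that cSUP_upper[of x ?B "\<lambda>x. \<bar>T x\<bar>"] by (simp add: dual_space_def op_space_def)
  show ?thesis
  proof (cases "vnorm E x = 0")
    case True
    then show ?thesis using K(2)[OF x] by simp
  next
    case False
    then have pos: "vnorm E x > 0" using E.norm_nonneg[OF x] by simp
    have "\<bar>T (vscale E (inverse (vnorm E x)) x)\<bar> \<le> vnorm (dual_space E) T"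
      using x pos by (intro up) (simp add: E.scale_closed E.norm_scale)
    then show ?thesis
      using pos by (simp add: linear_maps_scale[OF lin x] abs_mult field_simps)
  qed
qed

lemma dual_norm_le:
  assumes E: "normed_space E" and K: "K \<ge> 0"
    and le: "\<And>x. x \<in> vcarrier E \<Longrightarrow> \<bar>T x\<bar> \<le> K * vnorm E x"
  shows "vnorm (dual_space E) T \<le> K"
proof -
  interpret E: normed_space E by fact
  have "\<bar>T x\<bar> \<le> K" if "x \<in> vcarrier E" "vnorm E x \<le> 1" for x
    using le[OF that(1)] mult_left_mono[OF that(2) K] by simp
  moreover have "{x \<in> vcarrier E. vnorm E x \<le> 1} \<noteq> {}"
    using E.zero_closed E.norm_zero by (auto intro!: exI[of _ "vzero E"])
  ultimately show ?thesis
    by (auto simp: dual_space_def op_space_def intro!: cSUP_least)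
qed

lemma normed_space_dual:
  assumes E: "normed_space E"
  shows "normed_space (dual_space E)"
proof -
  interpret E: normed_space E by fact
  let ?W = "dual_space E"
  have lin: "T (vadd E x y) = T x + T y" "T (vscale E a x) = a * T x"
    if "T \<in> bounded_ops E real_space" "x \<in> vcarrier E" "y \<in> vcarrier E" for T a x y
    using linear_maps_add[OF bounded_ops_linear[OF that(1)] that(2,3)]
      linear_maps_scale[OF bounded_ops_linear[OF that(1)] that(2)] by simp_all
  show ?thesis
  proof (rule normed_space_of_least_bound[where S = "vcarrier E"
        and I = "vcarrier E" and e = "\<lambda>x T. T x" and w = "vnorm E"])
    show "vcarrier ?W \<subseteq> extensional (vcarrier E)" by (auto simp: bounded_ops_extensional)
    show "vzero ?W \<in> vcarrier ?W"
      by (auto simp: fun_ops_real bounded_ops_def linear_maps_def E.add_closed E.scale_closed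
          intro!: exI[of _ 0])
    show "vadd ?W f g \<in> vcarrier ?W" if fg: "f \<in> vcarrier ?W" "g \<in> vcarrier ?W" for f g
    proof -
      have "\<bar>f x + g x\<bar> \<le> (vnorm ?W f + vnorm ?W g) * vnorm E x" if "x \<in> vcarrier E" for x
        using dual_norm_bound[OF E _ that, of f] dual_norm_bound[OF E _ that, of g] fg
        unfolding distrib_right by simp
      then have "\<exists>K. \<forall>x\<in>vcarrier E. \<bar>f x + g x\<bar> \<le> K * vnorm E x" by blast
      then show ?thesis
        using fg by (simp add: bounded_ops_def[of E] linear_maps_def fun_ops_real E.add_closed
            E.scale_closed algebra_simps)
    qed
    show "vscale ?W a f \<in> vcarrier ?W" if f: "f \<in> vcarrier ?W" for a f
    proof -
      have "\<bar>a * f x\<bar> \<le> (\<bar>a\<bar> * vnorm ?W f) * vnorm E x" if "x \<in> vcarrier E" for x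
        using mult_left_mono[OF dual_norm_bound[OF E _ that, of f] abs_ge_zero[of a]] f
        by (simp add: abs_mult mult.assoc)
      then have "\<exists>K. \<forall>x\<in>vcarrier E. \<bar>a * f x\<bar> \<le> K * vnorm E x" by blast
      then show ?thesis
        using f by (simp add: bounded_ops_def[of E] linear_maps_def fun_ops_real E.add_closed
            E.scale_closed algebra_simps)
    qed
    show "f = vzero ?W" if "f \<in> vcarrier ?W" "\<And>x. x \<in> vcarrier E \<Longrightarrow> f x = 0" for f
      using that by (intro extensionalityI[of f "vcarrier E"])
        (auto simp: fun_ops_real bounded_ops_extensional)
    show "0 \<le> vnorm ?W f" if f: "f \<in> vcarrier ?W" for f
    proof -
      have "bdd_above ((\<lambda>x. \<bar>f x\<bar>) ` {x \<in> vcarrier E. vnorm E x \<le> 1})"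
      proof -
        obtain K where "K \<ge> 0" "\<And>x. x \<in> vcarrier E \<Longrightarrow> \<bar>f x\<bar> \<le> K * vnorm E x"
          using bounded_ops_bound[of f E real_space] f E by auto
        then have "\<bar>f x\<bar> \<le> K" if "x \<in> vcarrier E" "vnorm E x \<le> 1" for x
          using that mult_left_mono[of "vnorm E x" 1 K] by fastforce
        then show ?thesis by (intro bdd_aboveI2) auto
      qed
      then have "\<bar>f (vzero E)\<bar> \<le> vnorm ?W f"
        using E.zero_closed E.norm_zero
        by (auto simp: dual_space_def op_space_def intro!: cSUP_upper)
      then show ?thesis by linarith
    qed
    show "\<bar>f x\<bar> \<le> vnorm ?W f * vnorm E x" if "x \<in> vcarrier E" "f \<in> vcarrier ?W" for x f
      using dual_norm_bound[OF E _ that(1)] that(2) by simp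
    show "vnorm ?W f \<le> K" if "K \<ge> 0" "\<And>x. x \<in> vcarrier E \<Longrightarrow> \<bar>f x\<bar> \<le> K * vnorm E x" for f K
      using that by (rule dual_norm_le[OF E])
  qed (auto simp: fun_ops_real)
qed

lemma dual_vdiff_apply:
  "x \<in> vcarrier E \<Longrightarrow> vdiff (dual_space E) S T x = S x - T x"
  by (simp add: vdiff_def fun_ops_real)

lemma dual_vdist_bound:
  assumes E: "normed_space E" and S: "S \<in> bounded_ops E real_space"
    and T: "T \<in> bounded_ops E real_space" and x: "x \<in> vcarrier E"
  shows "\<bar>S x - T x\<bar> \<le> vdist (dual_space E) S T * vnorm E x"
proof -
  interpret D: normed_space "dual_space E" by (rule normed_space_dual[OF E])
  have "vdiff (dual_space E) S T \<in> bounded_ops E real_space"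
    using D.diff_closed[of S T] S T by simp
  from dual_norm_bound[OF E this x] show ?thesis
    using S T x by (simp add: D.vdist_eq dual_vdiff_apply)
qed

lemma dual_vdist_le:
  assumes E: "normed_space E" and S: "S \<in> bounded_ops E real_space"
    and T: "T \<in> bounded_ops E real_space" and K: "K \<ge> 0"
    and le: "\<And>x. x \<in> vcarrier E \<Longrightarrow> \<bar>S x - T x\<bar> \<le> K * vnorm E x"
  shows "vdist (dual_space E) S T \<le> K"
proof -
  interpret D: normed_space "dual_space E" by (rule normed_space_dual[OF E])
  show ?thesis
    using S T le by (simp add: D.vdist_eq dual_norm_le[OF E K] dual_vdiff_apply)
qed

text \<open>
  A Cauchy sequence of functionals converges pointwise, uniformly on the unit ball; the pointwise
  limit is again linear and bounded.
\<close>

lemma banach_space_dual: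
  assumes E: "normed_space E"
  shows "banach_space (dual_space E)"
proof (rule banach_spaceI[OF normed_space_dual[OF E]])
  interpret E: normed_space E by fact
  let ?D = "dual_space E"
  fix s :: "nat \<Rightarrow> 'a \<Rightarrow> real"
  assume "\<And>n. s n \<in> vcarrier ?D"
    and cau: "\<And>e. e > 0 \<Longrightarrow> \<exists>N. \<forall>m\<ge>N. \<forall>n\<ge>N. vdist ?D (s m) (s n) < e"
  then have s: "s n \<in> bounded_ops E real_space" for n by simp
  note sl = bounded_ops_linear[OF s]
  have "Cauchy (\<lambda>n. s n x)" if x: "x \<in> vcarrier E" for x
  proof (rule metric_CauchyI)
    fix e :: real assume e: "e > 0"
    have nn: "vnorm E x \<ge> 0" using x by (rule E.norm_nonneg)
    have pos: "e / (vnorm E x + 1) > 0" using e nn by simp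
    obtain N where N: "\<forall>m\<ge>N. \<forall>n\<ge>N. vdist ?D (s m) (s n) < e / (vnorm E x + 1)"
      using cau[OF pos] by blast
    have "dist (s m x) (s n x) < e" if "m \<ge> N" "n \<ge> N" for m n
    proof -
      have "\<bar>s m x - s n x\<bar> \<le> vdist ?D (s m) (s n) * vnorm E x"
        by (rule dual_vdist_bound[OF E s s x])
      also have "\<dots> \<le> e / (vnorm E x + 1) * vnorm E x"
        using N that nn by (intro mult_right_mono) (auto intro: less_imp_le)
      also have "\<dots> < e" using e nn by (simp add: field_simps)
      finally show ?thesis by (simp add: dist_real_def)
    qed
    then show "\<exists>N. \<forall>m\<ge>N. \<forall>n\<ge>N. dist (s m x) (s n x) < e" by blast
  qed
  then have conv: "(\<lambda>n. s n x) \<longlonglongrightarrow> lim (\<lambda>n. s n x)" if "x \<in> vcarrier E" for x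
    using that by (simp add: Cauchy_convergent_iff convergent_LIMSEQ_iff)
  define T where "T = (\<lambda>x\<in>vcarrier E. lim (\<lambda>n. s n x))"
  have T: "(\<lambda>n. s n x) \<longlonglongrightarrow> T x" if "x \<in> vcarrier E" for x
    using conv[OF that] that by (simp add: T_def)
  have close: "\<exists>N. \<forall>n\<ge>N. \<forall>x\<in>vcarrier E. \<bar>s n x - T x\<bar> \<le> e * vnorm E x" if e: "e > 0" for e
  proof -
    obtain N where N: "\<forall>m\<ge>N. \<forall>n\<ge>N. vdist ?D (s m) (s n) < e" using cau[OF e] by blast
    have "\<bar>s n x - T x\<bar> \<le> e * vnorm E x" if n: "n \<ge> N" and x: "x \<in> vcarrier E" for n x
    proof (rule tendsto_le[OF sequentially_bot tendsto_const])
      show "(\<lambda>m. \<bar>s n x - s m x\<bar>) \<longlonglongrightarrow> \<bar>s n x - T x\<bar>"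
        by (intro tendsto_intros T x)
      have "\<bar>s n x - s m x\<bar> \<le> e * vnorm E x" if "m \<ge> N" for m
      proof -
        have "vdist ?D (s n) (s m) \<le> e" using N n that by (auto intro: less_imp_le)
        from mult_right_mono[OF this E.norm_nonneg[OF x]] show ?thesis
          using dual_vdist_bound[OF E s s x, of n m] by linarith
      qed
      then show "\<forall>\<^sub>F m in sequentially. \<bar>s n x - s m x\<bar> \<le> e * vnorm E x"
        by (auto simp: eventually_sequentially)
    qed
    then show ?thesis by blast
  qed
  have Tadd: "T (vadd E x y) = T x + T y" if xy: "x \<in> vcarrier E" "y \<in> vcarrier E" for x y
  proof (rule LIMSEQ_unique[OF T[OF E.add_closed[OF xy]]])
    have "(\<lambda>n. s n (vadd E x y)) = (\<lambda>n. s n x + s n y)"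
      using linear_maps_add[OF sl xy] by simp
    then show "(\<lambda>n. s n (vadd E x y)) \<longlonglongrightarrow> T x + T y"
      using tendsto_add[OF T[OF xy(1)] T[OF xy(2)]] by simp
  qed
  have Tscale: "T (vscale E a x) = a * T x" if x: "x \<in> vcarrier E" for a x
  proof (rule LIMSEQ_unique[OF T[OF E.scale_closed[OF x]]])
    have "(\<lambda>n. s n (vscale E a x)) = (\<lambda>n. a * s n x)"
      using linear_maps_scale[OF sl x] by simp
    then show "(\<lambda>n. s n (vscale E a x)) \<longlonglongrightarrow> a * T x"
      using tendsto_mult_left[OF T[OF x]] by simp
  qed
  have TD: "T \<in> bounded_ops E real_space"
  proof -
    obtain n where n: "\<And>x. x \<in> vcarrier E \<Longrightarrow> \<bar>s n x - T x\<bar> \<le> 1 * vnorm E x"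
      using close[of 1] by auto
    have "\<bar>T x\<bar> \<le> (1 + vnorm ?D (s n)) * vnorm E x" if "x \<in> vcarrier E" for x
      using n[OF that] dual_norm_bound[OF E s that, of n] unfolding distrib_right by linarith
    then have "\<exists>K. \<forall>x\<in>vcarrier E. \<bar>T x\<bar> \<le> K * vnorm E x" by blast
    then show ?thesis using Tadd Tscale by (simp add: bounded_ops_def linear_maps_def T_def)
  qed
  show "\<exists>T\<in>vcarrier ?D. \<forall>e>0. \<exists>N. \<forall>n\<ge>N. vdist ?D (s n) T < e"
  proof (intro bexI[of _ T] allI impI)
    fix e :: real assume e: "e > 0"
    obtain N where "\<forall>n\<ge>N. \<forall>x\<in>vcarrier E. \<bar>s n x - T x\<bar> \<le> (e / 2) * vnorm E x"
      using close[of "e / 2"] e by auto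
    then have "vdist ?D (s n) T \<le> e / 2" if "n \<ge> N" for n
      using that e by (intro dual_vdist_le[OF E s TD]) auto
    then show "\<exists>N. \<forall>n\<ge>N. vdist ?D (s n) T < e" using e by (intro exI[of _ N]) fastforce
  qed (simp add: TD)
qed


section \<open>Closed subspaces\<close>

lemma sub_space_simps [simp]:
  "vcarrier (sub_space V S) = S" "vzero (sub_space V S) = vzero V" "vadd (sub_space V S) = vadd V"
  "vscale (sub_space V S) = vscale V" "vnorm (sub_space V S) = vnorm V"
  "vdiff (sub_space V S) = vdiff V"
  by (simp_all add: sub_space_def vdiff_def fun_eq_iff)

lemma vdist_sub_space:
  "\<lbrakk>linear_subspace V S; x \<in> S; y \<in> S\<rbrakk> \<Longrightarrow> vdist (sub_space V S) x y = vdist V x y"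
  by (auto simp: vdist_def linear_subspace_def)

lemma normed_space_sub_space:
  assumes V: "normed_space V" and S: "linear_subspace V S"
  shows "normed_space (sub_space V S)"
proof -
  interpret normed_space V by fact
  have sub: "x \<in> vcarrier V" if "x \<in> S" for x using S that by (auto simp: linear_subspace_def)
  show ?thesis
    using S by unfold_locales
      (auto simp: linear_subspace_def sub add_assoc add_zero add_inverse scale_add_right
        scale_add_left scale_scale scale_one norm_nonneg norm_eq_zero norm_scale norm_triangle
        intro: add_commute)
qed

lemma banach_space_sub_space:
  assumes V: "banach_space V" and S: "linear_subspace V S" and cl: "vtop V closure_of S \<subseteq> S"
  shows "banach_space (sub_space V S)"
proof (rule banach_spaceI[OF normed_space_sub_space[OF banach_space.axioms(1)[OF V] S]])
  interpret banach_space V by fact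
  have sub: "S \<subseteq> vcarrier V" using S by (simp add: linear_subspace_def)
  fix s :: "nat \<Rightarrow> 'a"
  assume "\<And>n. s n \<in> vcarrier (sub_space V S)"
    and cau: "\<And>e. e > 0 \<Longrightarrow> \<exists>N. \<forall>m\<ge>N. \<forall>n\<ge>N. vdist (sub_space V S) (s m) (s n) < e"
  then have s: "s n \<in> S" for n by simp
  then have sV: "s n \<in> vcarrier V" for n using sub by blast
  obtain x where x: "x \<in> vcarrier V" "\<And>e. e > 0 \<Longrightarrow> \<exists>N. \<forall>n\<ge>N. vdist V (s n) x < e"
    using Cauchy_limit[of s] sV cau s by (auto simp: vdist_sub_space[OF S])
  have "\<exists>y\<in>S. vdist V x y < e" if e: "e > 0" for e
  proof -
    obtain N where "\<forall>n\<ge>N. vdist V (s n) x < e" using x(2)[OF e] by blast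
    then have "vdist V x (s N) < e" by (simp add: metric.commute)
    then show ?thesis using s by blast
  qed
  then have "x \<in> S" using cl x(1) in_closure_iff[OF sub, of x] by blast
  then show "\<exists>x\<in>vcarrier (sub_space V S). \<forall>e>0. \<exists>N. \<forall>n\<ge>N. vdist (sub_space V S) (s n) x < e"
    using x(2) s by (auto simp: vdist_sub_space[OF S])
qed

lemma (in normed_space) linear_subspace_closure:
  assumes S: "linear_subspace V S"
  shows "linear_subspace V (vtop V closure_of S)"
proof -
  have sub: "S \<subseteq> vcarrier V" using S by (simp add: linear_subspace_def)
  note cl = in_closure_iff[OF sub]
  have "vzero V \<in> vtop V closure_of S"
    using S closure_of_subset[of S "vtop V"] sub by (auto simp: linear_subspace_def topspace_vtop)
  moreover have "vadd V x y \<in> vtop V closure_of S"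
    if xy: "x \<in> vtop V closure_of S" "y \<in> vtop V closure_of S" for x y
    unfolding cl
  proof (intro conjI allI impI)
    have C: "x \<in> vcarrier V" "y \<in> vcarrier V" using xy by (auto simp: cl)
    then show "vadd V x y \<in> vcarrier V" by (rule add_closed)
    fix e :: real assume "e > 0"
    then obtain u v where uv: "u \<in> S" "vdist V x u < e / 2" "v \<in> S" "vdist V y v < e / 2"
      using xy unfolding cl by (meson half_gt_zero)
    then have UV: "u \<in> vcarrier V" "v \<in> vcarrier V" using sub by auto
    have "vdist V (vadd V x y) (vadd V u v) \<le> vdist V x u + vdist V y v"
      using C UV norm_triangle[OF diff_closed diff_closed, of x u y v]
      by (simp add: vdist_eq add_closed diff_add_add)
    moreover have "vadd V u v \<in> S" using S uv by (auto simp: linear_subspace_def)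
    ultimately show "\<exists>z\<in>S. vdist V (vadd V x y) z < e"
      using uv by (intro bexI[of _ "vadd V u v"]) auto
  qed
  moreover have "vscale V a x \<in> vtop V closure_of S" if x: "x \<in> vtop V closure_of S" for a x
    unfolding cl
  proof (intro conjI allI impI)
    have C: "x \<in> vcarrier V" using x by (auto simp: cl)
    then show "vscale V a x \<in> vcarrier V" by (rule scale_closed)
    fix e :: real assume e: "e > 0"
    then have "e / (\<bar>a\<bar> + 1) > 0" by simp
    then obtain u where u: "u \<in> S" "vdist V x u < e / (\<bar>a\<bar> + 1)" using x unfolding cl by blast
    then have U: "u \<in> vcarrier V" using sub by auto
    have "vdist V (vscale V a x) (vscale V a u) = \<bar>a\<bar> * vdist V x u"
      using C U by (simp add: vdist_eq scale_closed diff_scale norm_scale diff_closed)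
    also have "\<dots> \<le> (\<bar>a\<bar> + 1) * vdist V x u"
      by (intro mult_right_mono) auto
    also have "\<dots> < e" using u(2) by (simp add: field_simps)
    finally have "vdist V (vscale V a x) (vscale V a u) < e" .
    moreover have "vscale V a u \<in> S" using S u by (auto simp: linear_subspace_def)
    ultimately show "\<exists>z\<in>S. vdist V (vscale V a x) z < e" by blast
  qed
  ultimately show ?thesis
    using closure_of_subset_topspace[of "vtop V" S] by (simp add: linear_subspace_def topspace_vtop)
qed

lemma (in normed_space) linear_subspace_lspan:
  assumes B: "B \<subseteq> vcarrier V"
  shows "linear_subspace V (lspan V B)"
proof -
  have "linear_subspace V (vcarrier V)"
    by (simp add: linear_subspace_def zero_closed add_closed scale_closed)
  then have "lspan V B \<subseteq> vcarrier V" using B by (auto simp: lspan_def)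
  then show ?thesis by (auto simp: linear_subspace_def lspan_def)
qed

lemma lspan_superset: "B \<subseteq> lspan V B"
  by (auto simp: lspan_def)

lemma lspan_least: "\<lbrakk>linear_subspace V S; B \<subseteq> S\<rbrakk> \<Longrightarrow> lspan V B \<subseteq> S"
  by (auto simp: lspan_def)


section \<open>The Lipschitz-free space\<close>

abbreviation lip_dual :: "'a nspace \<Rightarrow> (('a \<Rightarrow> real) \<Rightarrow> real) nspace" where
  "lip_dual X \<equiv> dual_space (Lip0_space X real_space)"

lemma delta_in_dual:
  assumes X: "normed_space X" and x: "x \<in> vcarrier X"
  shows "delta X x \<in> bounded_ops (Lip0_space X real_space) real_space"
proof -
  interpret X: normed_space X by fact
  interpret L: normed_space "Lip0_space X real_space" by (rule normed_space_Lip0[OF X])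
  have "\<bar>f x\<bar> \<le> vnorm X x * lip_norm X real_space f" if "f \<in> Lip0 X real_space" for f
    using lip_norm_bound[OF that X normed_space_real x X.zero_closed] x that
    by (simp add: Lip0_zero X.vdist_zero mult.commute)
  then have "\<exists>K. \<forall>f\<in>Lip0 X real_space. \<bar>f x\<bar> \<le> K * lip_norm X real_space f" by blast
  then show ?thesis
    using L.add_closed L.scale_closed x
    by (simp add: bounded_ops_def linear_maps_def delta_def fun_ops_real)
qed

lemma delta_apply: "f \<in> Lip0 X real_space \<Longrightarrow> delta X x f = f x"
  by (simp add: delta_def)

lemma delta_vdist_le:
  assumes X: "normed_space X" and xy: "x \<in> vcarrier X" "y \<in> vcarrier X"
  shows "vdist (lip_dual X) (delta X x) (delta X y) \<le> vdist X x y"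
proof -
  interpret X: normed_space X by fact
  show ?thesis
    using lip_norm_bound[OF _ X normed_space_real xy]
    by (intro dual_vdist_le normed_space_Lip0 X delta_in_dual xy X.metric.nonneg)
      (simp add: delta_apply mult.commute)
qed

lemma free_space_eq:
  "free_space X = sub_space (lip_dual X) (vcarrier (free_space X))"
  "vcarrier (free_space X) =
    vtop (lip_dual X) closure_of lspan (lip_dual X) (delta X ` vcarrier X)"
  by (simp_all add: free_space_def Let_def)

lemma free_space_simps:
  "vzero (free_space X) = vzero (lip_dual X)" "vadd (free_space X) = vadd (lip_dual X)"
  "vscale (free_space X) = vscale (lip_dual X)" "vnorm (free_space X) = vnorm (lip_dual X)"
  "vdiff (free_space X) = vdiff (lip_dual X)"
  by (subst free_space_eq(1), simp only: sub_space_simps)+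

lemma free_space_closed_subspace:
  assumes X: "normed_space X"
  shows "linear_subspace (lip_dual X) (vcarrier (free_space X))"
    and "banach_space (free_space X)"
    and "x \<in> vcarrier X \<Longrightarrow> delta X x \<in> vcarrier (free_space X)"
proof -
  let ?D = "lip_dual X" and ?B = "delta X ` vcarrier X"
  interpret D: banach_space ?D by (intro banach_space_dual normed_space_Lip0 X)
  have B: "?B \<subseteq> vcarrier ?D" using delta_in_dual[OF X] by auto
  have span: "linear_subspace ?D (lspan ?D ?B)" by (rule D.linear_subspace_lspan[OF B])
  show sub: "linear_subspace ?D (vcarrier (free_space X))"
    unfolding free_space_eq(2) by (rule D.linear_subspace_closure[OF span])
  have "banach_space (sub_space ?D (vcarrier (free_space X)))"
    by (rule banach_space_sub_space[OF D.banach_space_axioms sub]) (simp add: free_space_eq(2))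
  then show "banach_space (free_space X)" by (simp flip: free_space_eq(1))
  have "lspan ?D ?B \<subseteq> vcarrier (free_space X)"
    using span unfolding free_space_eq(2)
    by (intro closure_of_subset) (simp add: D.topspace_vtop linear_subspace_def)
  then show "delta X x \<in> vcarrier (free_space X)" if "x \<in> vcarrier X"
    using that lspan_superset[of ?B ?D] by blast
qed

text \<open>
  The induction principle of the free space: to show that all its elements have some property, check
  that the property holds at the \<open>\<delta>\<^sub>x\<close> and defines a closed linear subspace.
\<close>

lemma free_space_least:
  assumes X: "normed_space X" and S: "linear_subspace (lip_dual X) S"
    and delta: "\<And>x. x \<in> vcarrier X \<Longrightarrow> delta X x \<in> S"
    and closed: "\<And>m. \<lbrakk>m \<in> vcarrier (lip_dual X);
        \<And>e. e > 0 \<Longrightarrow> \<exists>s\<in>S. vdist (lip_dual X) m s < e\<rbrakk> \<Longrightarrow> m \<in> S"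
  shows "vcarrier (free_space X) \<subseteq> S"
proof -
  interpret D: normed_space "lip_dual X" by (intro normed_space_dual normed_space_Lip0 X)
  have "lspan (lip_dual X) (delta X ` vcarrier X) \<subseteq> S"
    using delta by (intro lspan_least[OF S]) auto
  then have "vcarrier (free_space X) \<subseteq> vtop (lip_dual X) closure_of S"
    unfolding free_space_eq(2) by (rule closure_of_mono)
  also have "\<dots> \<subseteq> S"
    using closed D.in_closure_iff[of S] S by (auto simp: linear_subspace_def)
  finally show ?thesis .
qed

text \<open>
  The elements where two bounded operators agree form a closed subspace.
\<close>

lemma bounded_ops_free_eqI:
  assumes X: "normed_space X" and Y: "normed_space Y"
    and S: "S \<in> bounded_ops (free_space X) Y" and T: "T \<in> bounded_ops (free_space X) Y"
    and eq: "\<And>x. x \<in> vcarrier X \<Longrightarrow> S (delta X x) = T (delta X x)"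
  shows "S = T"
proof -
  let ?D = "lip_dual X" and ?F = "free_space X"
  interpret D: normed_space ?D by (intro normed_space_dual normed_space_Lip0 X)
  interpret F: banach_space ?F by (rule free_space_closed_subspace(2)[OF X])
  interpret Y: normed_space Y by fact
  note sub = free_space_closed_subspace(1)[OF X]
  note dist = vdist_sub_space[OF sub, folded free_space_eq(1)]
  have FD: "m \<in> vcarrier ?D" if "m \<in> vcarrier ?F" for m
    using sub that by (auto simp: linear_subspace_def)
  note Sl = bounded_ops_linear[OF S] and Tl = bounded_ops_linear[OF T]
  obtain K where K: "K \<ge> 0" "\<And>m. m \<in> vcarrier ?F \<Longrightarrow> vnorm Y (S m) \<le> K * vnorm ?F m"
    using bounded_ops_bound[OF S F.normed_space_axioms] by blast
  obtain L where L: "L \<ge> 0" "\<And>m. m \<in> vcarrier ?F \<Longrightarrow> vnorm Y (T m) \<le> L * vnorm ?F m"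
    using bounded_ops_bound[OF T F.normed_space_axioms] by blast
  have Sd: "vdist Y (S m) (S m') \<le> K * vdist ?F m m'"
    and Td: "vdist Y (T m) (T m') \<le> L * vdist ?F m m'"
    if "m \<in> vcarrier ?F" "m' \<in> vcarrier ?F" for m m'
    using bounded_ops_vdist[OF S F.normed_space_axioms Y _ that, of K] K(2)
      bounded_ops_vdist[OF T F.normed_space_axioms Y _ that, of L] L(2) by blast+
  let ?E = "{m \<in> vcarrier ?F. S m = T m}"
  have "linear_subspace ?D ?E"
    using F.zero_closed F.add_closed F.scale_closed FD
      linear_maps_zero[OF Sl F.normed_space_axioms Y] linear_maps_zero[OF Tl F.normed_space_axioms Y]
      linear_maps_add[OF Sl] linear_maps_add[OF Tl] linear_maps_scale[OF Sl] linear_maps_scale[OF Tl]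
    by (simp add: linear_subspace_def subset_iff free_space_simps)
  then have "vcarrier ?F \<subseteq> ?E"
  proof (rule free_space_least[OF X])
    show "delta X x \<in> ?E" if "x \<in> vcarrier X" for x
      using that eq free_space_closed_subspace(3)[OF X] by simp
    fix m assume m: "m \<in> vcarrier ?D" and near: "\<And>e. e > 0 \<Longrightarrow> \<exists>s\<in>?E. vdist ?D m s < e"
    \<comment> \<open>\<open>?E\<close> lies in the free space, which is itself a closure, so a limit of points of \<open>?E\<close> stays there.\<close>
    have mF: "m \<in> vcarrier ?F"
      unfolding free_space_eq(2)
    proof (subst closure_of_closure_of[symmetric], subst D.in_closure_iff)
      show "vtop ?D closure_of lspan ?D (delta X ` vcarrier X) \<subseteq> vcarrier ?D"
        using closure_of_subset_topspace[of "vtop ?D"] by (simp only: D.topspace_vtop)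
      show "m \<in> vcarrier ?D \<and> (\<forall>e>0.
          \<exists>y\<in>vtop ?D closure_of lspan ?D (delta X ` vcarrier X). vdist ?D m y < e)"
        using m near unfolding free_space_eq(2)[symmetric] by blast
    qed
    have "vdist Y (S m) (T m) \<le> 0 + e" if e: "e > 0" for e
    proof -
      have "e / (K + L + 1) > 0" using e K(1) L(1) by simp
      then obtain s where s: "s \<in> vcarrier ?F" "S s = T s" "vdist ?F m s < e / (K + L + 1)"
        using near mF dist by fastforce
      have "vdist Y (S m) (T m) \<le> vdist Y (S m) (S s) + vdist Y (T s) (T m)"
        using Y.metric.triangle[of "S m" "S s" "T m"] s mF bounded_ops_closed[OF S]
          bounded_ops_closed[OF T] by simp
      also have "\<dots> \<le> K * vdist ?F m s + L * vdist ?F m s"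
        using Sd[OF mF s(1)] Td[OF s(1) mF] by (simp add: F.metric.commute)
      also have "\<dots> \<le> (K + L + 1) * vdist ?F m s"
        using F.metric.nonneg[of m s] by (simp add: algebra_simps)
      also have "\<dots> \<le> e" using s(3) K(1) L(1) by (simp add: field_simps)
      finally show ?thesis by simp
    qed
    then have "vdist Y (S m) (T m) \<le> 0" by (rule field_le_epsilon)
    then have "S m = T m"
      using Y.metric.zero[of "S m" "T m"] Y.metric.nonneg[of "S m" "T m"] mF
        bounded_ops_closed[OF S] bounded_ops_closed[OF T] by (metis order.antisym)
    then show "m \<in> ?E" using mF by simp
  qed
  then show ?thesis
    using bounded_ops_extensional[OF S] bounded_ops_extensional[OF T]
    by (intro extensionalityI[of S "vcarrier ?F"]) auto
qed

text \<open>
  Write \<open>rel m y\<close> if \<open>\<phi>(y) = m(\<phi> f)\<close> for all functionals \<open>\<phi>\<close> of norm at most 1.  This relation is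
  linear and relates \<open>\<delta>\<^sub>x\<close> to \<open>f(x)\<close>.  A norming functional for \<open>y - y'\<close> shows
  \<open>\<parallel>y - y'\<parallel> \<le> \<parallel>f\<parallel> \<parallel>m - m'\<parallel>\<close>, where \<open>\<parallel>f\<parallel>\<close> is the Lipschitz norm; hence \<open>y\<close> is determined by \<open>m\<close>,
  and since \<open>Y\<close> is complete the domain of the relation is closed.  So the domain contains the free
  space, and on it the relation is the graph of the linearization.  Compared with extending from the
  span of the \<open>\<delta>\<^sub>x\<close> by density, this needs no choice of representations as linear combinations.
\<close>

theorem lip_linearization_exists:
  assumes X: "normed_space X" and Y: "banach_space Y" and f: "f \<in> Lip0 X Y"
  obtains L where "L \<in> bounded_ops (free_space X) Y"
    "\<And>x. x \<in> vcarrier X \<Longrightarrow> L (delta X x) = f x"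
proof -
  let ?D = "lip_dual X" and ?F = "free_space X" and ?L = "lip_norm X Y f"
  interpret Y: banach_space Y by fact
  have Yn: "normed_space Y" by (rule Y.normed_space_axioms)
  have Ln: "normed_space (Lip0_space X real_space)" by (rule normed_space_Lip0[OF X])
  interpret D: banach_space ?D by (rule banach_space_dual[OF Ln])
  have L0: "?L \<ge> 0" by (rule lip_norm_nonneg[OF f X Yn])
  define \<Phi> where
    "\<Phi> = {\<phi> \<in> linear_maps Y real_space. \<forall>y\<in>vcarrier Y. \<bar>\<phi> y\<bar> \<le> vnorm Y y}"
  define pull where "pull \<phi> = compose (vcarrier X) \<phi> f" for \<phi> :: "'b \<Rightarrow> real"
  define rel where "rel m y \<longleftrightarrow> y \<in> vcarrier Y \<and> (\<forall>\<phi>\<in>\<Phi>. m (pull \<phi>) = \<phi> y)" for m y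
  have phi_lin: "\<phi> \<in> linear_maps Y real_space" if "\<phi> \<in> \<Phi>" for \<phi> using that by (simp add: \<Phi>_def)
  have phi_ops: "\<phi> \<in> bounded_ops Y real_space" if "\<phi> \<in> \<Phi>" for \<phi>
    using that by (auto simp: \<Phi>_def bounded_ops_def intro!: exI[of _ 1])
  have phi_dist: "\<bar>\<phi> y - \<phi> z\<bar> \<le> vdist Y y z"
    if "\<phi> \<in> \<Phi>" "y \<in> vcarrier Y" "z \<in> vcarrier Y" for \<phi> y z
    using bounded_ops_vdist[OF phi_ops[OF that(1)] Yn normed_space_real _ that(2,3), of 1] that(1)
    by (simp add: \<Phi>_def)
  have pull_in: "pull \<phi> \<in> Lip0 X real_space" if "\<phi> \<in> \<Phi>" for \<phi>
    unfolding pull_def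
    by (rule Lip0_compose(1)[OF f bounded_ops_Lip0[OF phi_ops[OF that] Yn normed_space_real] X Yn
          normed_space_real])
  have pull_norm: "lip_norm X real_space (pull \<phi>) \<le> ?L" if "\<phi> \<in> \<Phi>" for \<phi>
  proof (rule lip_norm_le[OF X L0])
    fix x y assume xy: "x \<in> vcarrier X" "y \<in> vcarrier X"
    have "\<bar>\<phi> (f x) - \<phi> (f y)\<bar> \<le> vdist Y (f x) (f y)"
      using that xy f by (intro phi_dist) (auto simp: Lip0_closed)
    also have "\<dots> \<le> ?L * vdist X x y" by (rule lip_norm_bound[OF f X Yn xy])
    finally show "vdist real_space (pull \<phi> x) (pull \<phi> y) \<le> ?L * vdist X x y"
      using xy by (simp add: pull_def compose_def)
  qed
  have pull_dist: "\<bar>m (pull \<phi>) - m' (pull \<phi>)\<bar> \<le> ?L * vdist ?D m m'"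
    if "\<phi> \<in> \<Phi>" "m \<in> vcarrier ?D" "m' \<in> vcarrier ?D" for \<phi> m m'
  proof -
    have "\<bar>m (pull \<phi>) - m' (pull \<phi>)\<bar> \<le> vdist ?D m m' * lip_norm X real_space (pull \<phi>)"
      using dual_vdist_bound[OF Ln _ _ _, of m m' "pull \<phi>"] that pull_in by simp
    also have "\<dots> \<le> vdist ?D m m' * ?L"
      by (rule mult_left_mono[OF pull_norm[OF that(1)] D.metric.nonneg])
    finally show ?thesis by (simp only: mult.commute)
  qed
  have rel_dist: "vdist Y y y' \<le> ?L * vdist ?D m m'"
    if "m \<in> vcarrier ?D" "m' \<in> vcarrier ?D" "rel m y" "rel m' y'" for m m' y y'
  proof -
    have yy: "y \<in> vcarrier Y" "y' \<in> vcarrier Y" using that by (auto simp: rel_def)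
    obtain \<phi> where \<phi>: "\<phi> \<in> \<Phi>" and \<phi>_norm: "\<phi> (vdiff Y y y') = vnorm Y (vdiff Y y y')"
      using Y.norming_functional[OF Y.diff_closed[OF yy]] unfolding \<Phi>_def by auto
    have "vdist Y y y' = \<phi> (vdiff Y y y')"
      using \<phi>_norm yy by (simp add: Y.vdist_eq)
    also have "\<dots> = \<phi> y - \<phi> y'"
      using linear_maps_diff[OF phi_lin[OF \<phi>] yy Yn] by (simp add: vdiff_def)
    also have "\<dots> = m (pull \<phi>) - m' (pull \<phi>)"
      using that \<phi> by (simp add: rel_def)
    also have "\<dots> \<le> ?L * vdist ?D m m'"
      using pull_dist[OF \<phi> that(1,2)] by linarith
    finally show ?thesis .
  qed
  have rel_unique: "y = y'" if "m \<in> vcarrier ?D" "rel m y" "rel m y'" for m y y'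
  proof -
    have yy: "y \<in> vcarrier Y" "y' \<in> vcarrier Y" using that by (auto simp: rel_def)
    have "vdist Y y y' \<le> 0"
      using rel_dist[OF that(1,1,2,3)] that(1) by (simp del: dual_space_simps)
    then have "vdist Y y y' = 0" using Y.metric.nonneg[of y y'] by linarith
    then show ?thesis using Y.metric.zero[OF yy] by simp
  qed
  have rel_add: "rel (vadd ?D m m') (vadd Y y y')" if "rel m y" "rel m' y'" for m m' y y'
    using that pull_in linear_maps_add[OF phi_lin] by (simp add: rel_def fun_ops_real Y.add_closed)
  have rel_scale: "rel (vscale ?D a m) (vscale Y a y)" if "rel m y" for a m y
    using that pull_in linear_maps_scale[OF phi_lin]
    by (simp add: rel_def fun_ops_real Y.scale_closed)
  have rel_zero: "rel (vzero ?D) (vzero Y)"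
    using pull_in linear_maps_zero[OF phi_lin Yn normed_space_real]
    by (simp add: rel_def fun_ops_real Y.zero_closed)
  have rel_delta: "rel (delta X x) (f x)" if "x \<in> vcarrier X" for x
    using that pull_in f by (simp add: rel_def delta_apply Lip0_closed) (simp add: pull_def compose_def)
  let ?S = "{m \<in> vcarrier ?D. \<exists>y. rel m y}"
  have "vcarrier ?F \<subseteq> ?S"
  proof (rule free_space_least[OF X])
    show "linear_subspace ?D ?S"
      using D.zero_closed D.add_closed D.scale_closed rel_zero rel_add rel_scale
      unfolding linear_subspace_def by blast
    show "delta X x \<in> ?S" if "x \<in> vcarrier X" for x
      using rel_delta[OF that] delta_in_dual[OF X that] by auto
    fix m assume m: "m \<in> vcarrier ?D" and near: "\<And>e. e > 0 \<Longrightarrow> \<exists>s\<in>?S. vdist ?D m s < e"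
    have "\<exists>s y. s \<in> vcarrier ?D \<and> rel s y \<and> vdist ?D m s < inverse (real (Suc n))" for n
      using near[of "inverse (real (Suc n))"] by auto
    then obtain s y where s: "\<And>n. s n \<in> vcarrier ?D" and y: "\<And>n. rel (s n) (y n)"
      and lt: "\<And>n. vdist ?D m (s n) < inverse (real (Suc n))"
      by metis
    have sm: "(\<lambda>n. vdist ?D m (s n)) \<longlonglongrightarrow> 0"
    proof (rule tendsto_sandwich[OF _ _ tendsto_const LIMSEQ_inverse_real_of_nat])
      show "\<forall>\<^sub>F n in sequentially. vdist ?D m (s n) \<le> inverse (real (Suc n))"
        by (intro always_eventually allI less_imp_le lt)
    qed simp
    have yY: "y n \<in> vcarrier Y" for n using y by (simp add: rel_def)
    have "\<exists>N. \<forall>i\<ge>N. \<forall>j\<ge>N. vdist Y (y i) (y j) < e" if e: "e > 0" for e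
    proof -
      have "e / (?L + 1) / 2 > 0" using e L0 by simp
      then obtain N where N: "\<forall>n\<ge>N. vdist ?D m (s n) < e / (?L + 1) / 2"
        using LIMSEQ_D[OF sm] by fastforce
      have "vdist Y (y i) (y j) < e" if ij: "i \<ge> N" "j \<ge> N" for i j
      proof -
        have "vdist ?D (s i) (s j) \<le> vdist ?D m (s i) + vdist ?D m (s j)"
          using D.metric.triangle[OF s m s, of i j] by (simp add: D.metric.commute)
        also have "\<dots> < e / (?L + 1) / 2 + e / (?L + 1) / 2"
          using N ij by (intro add_strict_mono) auto
        also have "\<dots> = e / (?L + 1)" by (rule field_sum_of_halves)
        finally have "(?L + 1) * vdist ?D (s i) (s j) < e" using L0 by (simp add: pos_less_divide_eq mult.commute)
        then show ?thesis
          using rel_dist[OF s s y y, of i j] D.metric.nonneg[of "s i" "s j"]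
          unfolding distrib_right by linarith
      qed
      then show ?thesis by blast
    qed
    then obtain z where z: "z \<in> vcarrier Y" "\<And>e. e > 0 \<Longrightarrow> \<exists>N. \<forall>n\<ge>N. vdist Y (y n) z < e"
      using Y.Cauchy_limit[of y] yY by blast
    have yz: "(\<lambda>n. vdist Y (y n) z) \<longlonglongrightarrow> 0"
      using z(2) by (intro LIMSEQ_I) (simp add: Y.metric.nonneg)
    have "m (pull \<phi>) = \<phi> z" if \<phi>: "\<phi> \<in> \<Phi>" for \<phi>
    proof -
      have "\<bar>m (pull \<phi>) - \<phi> z\<bar> \<le> 0"
      proof (rule tendsto_le[OF sequentially_bot])
        show "(\<lambda>n. ?L * vdist ?D m (s n) + vdist Y (y n) z) \<longlonglongrightarrow> 0"
          using tendsto_add[OF tendsto_mult_left[OF sm, of ?L] yz] by simp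
        show "(\<lambda>n. \<bar>m (pull \<phi>) - \<phi> z\<bar>) \<longlonglongrightarrow> \<bar>m (pull \<phi>) - \<phi> z\<bar>" by (rule tendsto_const)
        have "\<bar>m (pull \<phi>) - \<phi> z\<bar> \<le> ?L * vdist ?D m (s n) + vdist Y (y n) z" for n
        proof -
          have "s n (pull \<phi>) = \<phi> (y n)" using y \<phi> by (simp add: rel_def)
          then show ?thesis
            using pull_dist[OF \<phi> m s, of n] phi_dist[OF \<phi> yY z(1), of n] by linarith
        qed
        then show "\<forall>\<^sub>F n in sequentially. \<bar>m (pull \<phi>) - \<phi> z\<bar> \<le> ?L * vdist ?D m (s n) + vdist Y (y n) z"
          by simp
      qed
      then show ?thesis by simp
    qed
    then show "m \<in> ?S" using m z(1) by (auto simp: rel_def)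
  qed
  then have FD: "m \<in> vcarrier ?D" and ex: "\<exists>y. rel m y" if "m \<in> vcarrier ?F" for m
    using that by auto
  define T where "T = (\<lambda>m\<in>vcarrier ?F. THE y. rel m y)"
  have T: "rel m (T m)" if "m \<in> vcarrier ?F" for m
  proof -
    have "\<exists>!y. rel m y" using ex[OF that] rel_unique[OF FD[OF that]] by blast
    then show ?thesis using theI'[of "rel m"] that by (simp add: T_def)
  qed
  have T_eq: "T m = y" if "m \<in> vcarrier ?F" "rel m y" for m y
    using rel_unique[OF FD[OF that(1)] T[OF that(1)] that(2)] .
  interpret F: banach_space ?F by (rule free_space_closed_subspace(2)[OF X])
  have "T \<in> linear_maps ?F Y"
    unfolding linear_maps_def
  proof (intro CollectI conjI ballI allI)
    show "T \<in> vcarrier ?F \<rightarrow>\<^sub>E vcarrier Y"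
      using T by (auto simp: T_def rel_def)
    show "T (vadd ?F m m') = vadd Y (T m) (T m')" if "m \<in> vcarrier ?F" "m' \<in> vcarrier ?F" for m m'
      using rel_add[OF T T, of m m'] that F.add_closed[of m m'] 
      by (intro T_eq) (simp_all add: free_space_simps)
    show "T (vscale ?F a m) = vscale Y a (T m)" if "m \<in> vcarrier ?F" for a m
      using rel_scale[OF T, of m a] that F.scale_closed[of m a]
      by (intro T_eq) (simp_all add: free_space_simps)
  qed
  moreover have "vnorm Y (T m) \<le> ?L * vnorm ?F m" if m: "m \<in> vcarrier ?F" for m
    using rel_dist[OF FD[OF m] D.zero_closed T[OF m] rel_zero] T[OF m] FD[OF m]
    by (simp add: D.vdist_zero[OF FD[OF m]] Y.vdist_zero rel_def free_space_simps del: dual_space_simps)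
  ultimately have "T \<in> bounded_ops ?F Y" by (auto simp: bounded_ops_def)
  moreover have "T (delta X x) = f x" if "x \<in> vcarrier X" for x
    by (rule T_eq[OF free_space_closed_subspace(3)[OF X that] rel_delta[OF that]])
  ultimately show thesis using that by blast
qed

lemma lip_linearization:
  assumes X: "normed_space X" and Y: "banach_space Y" and f: "f \<in> Lip0 X Y"
  shows "lip_linearization X Y f \<in> bounded_ops (free_space X) Y"
    and "x \<in> vcarrier X \<Longrightarrow> lip_linearization X Y f (delta X x) = f x"
proof -
  obtain L where "L \<in> bounded_ops (free_space X) Y" "\<forall>x\<in>vcarrier X. L (delta X x) = f x"
    using lip_linearization_exists[OF X Y f] by metis
  then have "\<exists>!L. L \<in> bounded_ops (free_space X) Y \<and> (\<forall>x\<in>vcarrier X. L (delta X x) = f x)"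
    using bounded_ops_free_eqI[OF X banach_space.axioms(1)[OF Y]] by (metis (no_types, lifting))
  from theI'[OF this] show "lip_linearization X Y f \<in> bounded_ops (free_space X) Y"
    and "x \<in> vcarrier X \<Longrightarrow> lip_linearization X Y f (delta X x) = f x"
    unfolding lip_linearization_def by blast+
qed

lemma lip_linearization_eqI:
  assumes X: "normed_space X" and Y: "banach_space Y" and f: "f \<in> Lip0 X Y"
    and T: "T \<in> bounded_ops (free_space X) Y"
    and eq: "\<And>x. x \<in> vcarrier X \<Longrightarrow> T (delta X x) = f x"
  shows "lip_linearization X Y f = T"
  using lip_linearization[OF X Y f] T eq
  by (intro bounded_ops_free_eqI[OF X banach_space.axioms(1)[OF Y]]) auto


section \<open>Ideals under composition\<close>

text \<open>
  The maps \<open>h\<close> and \<open>k\<close> are there to compare cardinalities: they show that \<open>E0\<close> and \<open>F0\<close> have no more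
  points than \<open>E\<close> and \<open>F\<close>, whose copies in \<open>'u\<close> then leave room for copies of \<open>E0\<close> and \<open>F0\<close>.
\<close>

lemma in_ideal_compose:
  fixes A :: "'u op_family"
  assumes A: "operator_ideal A"
    and E: "banach_space E" and F: "banach_space F" and E0: "banach_space E0" and F0: "banach_space F0"
    and T: "in_ideal A E F T"
    and R: "R \<in> bounded_ops E0 E" and S: "S \<in> bounded_ops F F0"
    and h: "inj_on h (vcarrier E0)" "h ` vcarrier E0 \<subseteq> vcarrier E"
    and k: "inj_on k (vcarrier F0)" "k ` vcarrier F0 \<subseteq> vcarrier F"
  shows "in_ideal A E0 F0 (compose (vcarrier E0) S (compose (vcarrier E0) T R))"
proof -
  note ns = banach_space.axioms(1)
  note [intro] = ns[OF E] ns[OF F] ns[OF E0] ns[OF F0]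
  have TB: "T \<in> bounded_ops E F" using T by (simp add: in_ideal_def)
  obtain E' F' I J T' where E': "banach_space E'" and F': "banach_space F'"
    and I: "I \<in> isometric_isos E E'" and J: "J \<in> isometric_isos F F'"
    and T': "T' \<in> A E' F'" and com: "\<And>x. x \<in> vcarrier E \<Longrightarrow> T' (I x) = J (T x)"
    using T unfolding in_ideal_def by blast
  have bij: "bij_betw I (vcarrier E) (vcarrier E')" "bij_betw J (vcarrier F) (vcarrier F')"
    using I J by (simp_all add: isometric_isos_def)
  have "inj_on (I \<circ> h) (vcarrier E0)"
    using h bij(1) by (intro comp_inj_on) (auto simp: bij_betw_def intro: inj_on_subset)
  then obtain W :: "'u nspace" and I0 where W: "banach_space W" and I0: "I0 \<in> isometric_isos E0 W"
    using isometric_copy_exists[OF E0] by blast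
  have "inj_on (J \<circ> k) (vcarrier F0)"
    using k bij(2) by (intro comp_inj_on) (auto simp: bij_betw_def intro: inj_on_subset)
  then obtain W' :: "'u nspace" and J0 where W': "banach_space W'" and J0: "J0 \<in> isometric_isos F0 W'"
    using isometric_copy_exists[OF F0] by blast
  have bij0: "bij_betw I0 (vcarrier E0) (vcarrier W)"
    using I0 by (simp add: isometric_isos_def)
  note [intro] = ns[OF E'] ns[OF F'] ns[OF W] ns[OF W']
  define I1 where "I1 = (\<lambda>u\<in>vcarrier W. inv_into (vcarrier E0) I0 u)"
  define J1 where "J1 = (\<lambda>u\<in>vcarrier F'. inv_into (vcarrier F) J u)"
  have I1: "I1 \<in> bounded_ops W E0" and J1: "J1 \<in> bounded_ops F' F"
    unfolding I1_def J1_def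
    using isometric_isos_bounded[OF isometric_isos_inverse[OF I0 ns[OF E0]]]
      isometric_isos_bounded[OF isometric_isos_inverse[OF J ns[OF F]]] by blast+
  have I1I0: "I1 (I0 x) = x" "I0 x \<in> vcarrier W" if "x \<in> vcarrier E0" for x
    using that bij0 by (auto simp: I1_def bij_betw_def)
  have J1J: "J1 (J y) = y" "J y \<in> vcarrier F'" if "y \<in> vcarrier F" for y
    using that bij(2) by (auto simp: J1_def bij_betw_def)
  define R' where "R' = compose (vcarrier W) I (compose (vcarrier W) R I1)"
  define S' where "S' = compose (vcarrier F') J0 (compose (vcarrier F') S J1)"
  have R': "R' \<in> bounded_ops W E'"
    unfolding R'_def
    by (rule bounded_ops_compose[OF bounded_ops_compose[OF I1 R] isometric_isos_bounded[OF I]]) blast+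
  have S': "S' \<in> bounded_ops F' W'"
    unfolding S'_def
    by (rule bounded_ops_compose[OF bounded_ops_compose[OF J1 S] isometric_isos_bounded[OF J0]]) blast+
  have mem: "compose (vcarrier W) S' (compose (vcarrier W) T' R') \<in> A W W'"
    using A W E' F' W' R' T' S' unfolding operator_ideal_def by blast
  have eq: "compose (vcarrier W) S' (compose (vcarrier W) T' R') (I0 x)
      = J0 (compose (vcarrier E0) S (compose (vcarrier E0) T R) x)" if x: "x \<in> vcarrier E0" for x
  proof -
    have "R x \<in> vcarrier E" by (rule bounded_ops_closed[OF R x])
    then show ?thesis
      using x I1I0[OF x] com[of "R x"] J1J[of "T (R x)"] bounded_ops_closed[OF TB, of "R x"]
      by (simp add: compose_def R'_def S'_def)
  qed
  have "compose (vcarrier E0) S (compose (vcarrier E0) T R) \<in> bounded_ops E0 F0"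
    by (rule bounded_ops_compose[OF bounded_ops_compose[OF R TB] S]) blast+
  then show ?thesis
    unfolding in_ideal_def using W W' I0 J0 mem eq by blast
qed


section \<open>Passing to retracts\<close>

text \<open>
  \<open>R\<close> carries a Cauchy sequence of \<open>Z\<close> to one of \<open>X\<close>, and \<open>S\<close> carries its limit back.  This is how
  completeness of the quotient is obtained.
\<close>

lemma banach_space_retract:
  assumes Z: "normed_space Z" and X: "banach_space X"
    and R: "R \<in> bounded_ops Z X" and S: "S \<in> bounded_ops X Z"
    and SR: "\<And>z. z \<in> vcarrier Z \<Longrightarrow> S (R z) = z"
  shows "banach_space Z"
proof (rule banach_spaceI[OF Z])
  interpret X: banach_space X by fact
  interpret Z: normed_space Z by fact
  have RL: "R \<in> Lip0 Z X" and SL: "S \<in> Lip0 X Z"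
    by (rule bounded_ops_Lip0[OF R Z X.normed_space_axioms]
        bounded_ops_Lip0[OF S X.normed_space_axioms Z])+
  obtain K where K: "K > 0"
    "\<And>x y. \<lbrakk>x \<in> vcarrier Z; y \<in> vcarrier Z\<rbrakk> \<Longrightarrow> vdist X (R x) (R y) \<le> K * vdist Z x y"
    "\<And>x y. \<lbrakk>x \<in> vcarrier X; y \<in> vcarrier X\<rbrakk> \<Longrightarrow> vdist Z (S x) (S y) \<le> K * vdist X x y"
  proof
    let ?K = "1 + lip_norm Z X R + lip_norm X Z S"
    have nn: "lip_norm Z X R \<ge> 0" "lip_norm X Z S \<ge> 0"
      by (rule lip_norm_nonneg[OF RL Z X.normed_space_axioms]
          lip_norm_nonneg[OF SL X.normed_space_axioms Z])+
    then show "?K > 0" by simp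
    show "vdist X (R x) (R y) \<le> ?K * vdist Z x y" if "x \<in> vcarrier Z" "y \<in> vcarrier Z" for x y
      using lip_norm_bound[OF RL Z X.normed_space_axioms that] nn
        mult_right_mono[of "lip_norm Z X R" ?K "vdist Z x y"] Z.metric.nonneg[of x y] by linarith
    show "vdist Z (S x) (S y) \<le> ?K * vdist X x y" if "x \<in> vcarrier X" "y \<in> vcarrier X" for x y
      using lip_norm_bound[OF SL X.normed_space_axioms Z that] nn
        mult_right_mono[of "lip_norm X Z S" ?K "vdist X x y"] X.metric.nonneg[of x y] by linarith
  qed
  fix s :: "nat \<Rightarrow> 'a"
  assume s: "\<And>n. s n \<in> vcarrier Z"
    and cau: "\<And>e. e > 0 \<Longrightarrow> \<exists>N. \<forall>m\<ge>N. \<forall>n\<ge>N. vdist Z (s m) (s n) < e"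
  have Rs: "R (s n) \<in> vcarrier X" for n by (rule bounded_ops_closed[OF R s])
  have "\<exists>N. \<forall>m\<ge>N. \<forall>n\<ge>N. vdist X (R (s m)) (R (s n)) < e" if e: "e > 0" for e
  proof -
    obtain N where N: "\<forall>m\<ge>N. \<forall>n\<ge>N. vdist Z (s m) (s n) < e / K"
      using cau[of "e / K"] e K(1) by auto
    have "vdist X (R (s m)) (R (s n)) < e" if "m \<ge> N" "n \<ge> N" for m n
    proof -
      have "K * vdist Z (s m) (s n) < e" using N that K(1) by (simp add: field_simps)
      then show ?thesis using K(2)[OF s s, of m n] by linarith
    qed
    then show ?thesis by blast
  qed
  then obtain x where x: "x \<in> vcarrier X" "\<And>e. e > 0 \<Longrightarrow> \<exists>N. \<forall>n\<ge>N. vdist X (R (s n)) x < e"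
    using X.Cauchy_limit[of "\<lambda>n. R (s n)"] Rs by blast
  show "\<exists>z\<in>vcarrier Z. \<forall>e>0. \<exists>N. \<forall>n\<ge>N. vdist Z (s n) z < e"
  proof (intro bexI[of _ "S x"] allI impI)
    fix e :: real assume e: "e > 0"
    obtain N where N: "\<forall>n\<ge>N. vdist X (R (s n)) x < e / K"
      using x(2)[of "e / K"] e K(1) by auto
    have "vdist Z (s n) (S x) < e" if "n \<ge> N" for n
    proof -
      have "K * vdist X (R (s n)) x < e" using N that K(1) by (simp add: field_simps)
      then show ?thesis using K(3)[OF Rs x(1), of n] SR[OF s, of n] by simp
    qed
    then show "\<exists>N. \<forall>n\<ge>N. vdist Z (s n) (S x) < e" by blast
  qed (rule bounded_ops_closed[OF S x(1)])
qed

text \<open>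
  The subbasic set given by the empty compact set already contains every continuous map.
\<close>

lemma topspace_tau_c: "topspace (tau_c X Y) = cont_maps X Y"
proof -
  have "cont_maps X Y = {f \<in> cont_maps X Y. f ` {} \<subseteq> {}}" by simp
  then show ?thesis
    unfolding tau_c_def topology_generated_by_topspace
    using compactin_empty openin_empty by (auto simp del: image_empty)
qed

text \<open>
  \<open>S f R\<close> maps the compact set \<open>K\<close> into \<open>U\<close> exactly if \<open>f\<close> maps the compact set \<open>R(K)\<close> into the open
  set \<open>S\<inverse>(U)\<close>, so preimages of subbasic sets are subbasic.
\<close>

lemma continuous_map_conjugate_tau_c:
  assumes R: "continuous_map (vtop Z) (vtop X) R" and S: "continuous_map (vtop Y) (vtop W) S"
    and tZ: "topspace (vtop Z) = vcarrier Z" and tY: "topspace (vtop Y) = vcarrier Y"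
    and tX: "topspace (vtop X) = vcarrier X" and tW: "topspace (vtop W) = vcarrier W"
  shows "continuous_map (tau_c X Y) (tau_c Z W)
    (\<lambda>f. compose (vcarrier Z) S (compose (vcarrier Z) f R))" (is "continuous_map _ _ ?\<Phi>")
proof -
  have \<Phi>: "?\<Phi> f z = S (f (R z))" if "z \<in> vcarrier Z" for f z
    using that by (simp add: compose_def)
  have Rin: "R z \<in> vcarrier X" if "z \<in> vcarrier Z" for z
    using continuous_map_image_subset_topspace[OF R] that by (auto simp: tZ tX)
  have Sin: "S y \<in> vcarrier W" if "y \<in> vcarrier Y" for y
    using continuous_map_image_subset_topspace[OF S] that by (auto simp: tY tW)
  have cont: "?\<Phi> f \<in> cont_maps Z W" if f: "f \<in> cont_maps X Y" for f
  proof -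
    have "continuous_map (vtop Z) (vtop W) (S \<circ> (f \<circ> R))"
      using f R S by (intro continuous_map_compose) (auto simp: cont_maps_def)
    then have "continuous_map (vtop Z) (vtop W) (?\<Phi> f)"
      by (rule continuous_map_eq) (simp add: tZ compose_def)
    moreover have "f y \<in> vcarrier Y" if "y \<in> vcarrier X" for y
      using f that by (auto simp: cont_maps_def)
    ultimately show ?thesis
      using Rin Sin by (auto simp: cont_maps_def compose_def)
  qed
  show ?thesis
    unfolding tau_c_def[of Z W]
  proof (rule continuous_on_generated_topo)
    fix B assume "B \<in> {{f \<in> cont_maps Z W. f ` K \<subseteq> U} | K U. compactin (vtop Z) K \<and> openin (vtop W) U}"
    then obtain K U where B: "B = {f \<in> cont_maps Z W. f ` K \<subseteq> U}"
      and K: "compactin (vtop Z) K" and U: "openin (vtop W) U" by blast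
    have KZ: "K \<subseteq> vcarrier Z" using compactin_subset_topspace[OF K] by (simp add: tZ)
    let ?K = "R ` K" and ?U = "{y \<in> topspace (vtop Y). S y \<in> U}"
    have "compactin (vtop X) ?K" by (rule image_compactin[OF K R])
    moreover have "openin (vtop Y) ?U" by (rule openin_continuous_map_preimage[OF S U])
    ultimately have "openin (tau_c X Y) {f \<in> cont_maps X Y. f ` ?K \<subseteq> ?U}"
      unfolding tau_c_def by (intro topology_generated_by_Basis) blast
    also have "{f \<in> cont_maps X Y. f ` ?K \<subseteq> ?U} = ?\<Phi> -` B \<inter> topspace (tau_c X Y)"
    proof -
      have "f ` ?K \<subseteq> ?U \<longleftrightarrow> ?\<Phi> f ` K \<subseteq> U" if f: "f \<in> cont_maps X Y" for f
      proof -
        have "f (R z) \<in> vcarrier Y" if "z \<in> K" for z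
          using f that KZ Rin by (auto simp: cont_maps_def)
        then have "f ` ?K \<subseteq> ?U \<longleftrightarrow> (\<forall>z\<in>K. S (f (R z)) \<in> U)" by (auto simp: tY)
        also have "\<dots> \<longleftrightarrow> (\<forall>z\<in>K. ?\<Phi> f z \<in> U)"
          using KZ by (intro ball_cong refl) (auto simp: \<Phi>)
        finally show ?thesis by blast
      qed
      then show ?thesis using cont by (auto simp: B topspace_tau_c)
    qed
    finally show "openin (tau_c X Y) (?\<Phi> -` B \<inter> topspace (tau_c X Y))" .
  next
    show "?\<Phi> ` topspace (tau_c X Y) \<subseteq>
        \<Union>{{f \<in> cont_maps Z W. f ` K \<subseteq> U} | K U. compactin (vtop Z) K \<and> openin (vtop W) U}"
      using cont topspace_tau_c[of Z W] unfolding topspace_tau_c[of X]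
      unfolding tau_c_def topology_generated_by_topspace by blast
  qed
qed

lemma identity_bounded_op:
  assumes "normed_space E"
  shows "(\<lambda>x\<in>vcarrier E. x) \<in> bounded_ops E E"
  using normed_space.add_closed[OF assms] normed_space.scale_closed[OF assms]
  by (auto simp: bounded_ops_def linear_maps_def intro!: exI[of _ 1])

text \<open>
  Functoriality of the free space: the operators induced by \<open>R\<close> and \<open>S\<close> compose to an operator that
  fixes every \<open>\<delta>\<^sub>z\<close> and is therefore the identity.
\<close>

lemma free_map_injective_of_left_inverse:
  assumes X: "normed_space X" and Z: "normed_space Z"
    and R: "R \<in> Lip0 Z X" and S: "S \<in> Lip0 X Z"
    and SR: "\<And>z. z \<in> vcarrier Z \<Longrightarrow> S (R z) = z"
  obtains \<rho> where "\<rho> \<in> bounded_ops (free_space Z) (free_space X)"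
    "\<And>z. z \<in> vcarrier Z \<Longrightarrow> \<rho> (delta Z z) = delta X (R z)"
    "inj_on \<rho> (vcarrier (free_space Z))"
proof -
  have dlt: "(\<lambda>x\<in>vcarrier V. delta V x) \<in> Lip0 V (free_space V)" if V: "normed_space V" for V :: "'c nspace"
  proof (rule Lip0I[where K = 1])
    interpret V: normed_space V by fact
    interpret F: banach_space "free_space V" by (rule free_space_closed_subspace(2)[OF V])
    note dF = free_space_closed_subspace(3)[OF V]
    show "vdist (free_space V) ((\<lambda>x\<in>vcarrier V. delta V x) x) ((\<lambda>x\<in>vcarrier V. delta V x) y)
        \<le> 1 * vdist V x y" if "x \<in> vcarrier V" "y \<in> vcarrier V" for x y
      using delta_vdist_le[OF V that] that
        vdist_sub_space[OF free_space_closed_subspace(1)[OF V] dF[OF that(1)] dF[OF that(2)]]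
      by (simp flip: free_space_eq(1))
    have "delta V (vzero V) = fun_zero (Lip0 V real_space) real_space"
      by (auto simp: delta_def fun_ops_real Lip0_zero)
    then show "(\<lambda>x\<in>vcarrier V. delta V x) (vzero V) = vzero (free_space V)"
      by (simp add: free_space_simps V.zero_closed)
  qed (use free_space_closed_subspace(3)[OF V] in auto)
  have FX: "banach_space (free_space X)" and FZ: "banach_space (free_space Z)"
    by (rule free_space_closed_subspace(2)[OF X] free_space_closed_subspace(2)[OF Z])+
  note FXn = banach_space.axioms(1)[OF FX] and FZn = banach_space.axioms(1)[OF FZ]
  define \<rho> where "\<rho> = lip_linearization Z (free_space X) (compose (vcarrier Z) (\<lambda>x\<in>vcarrier X. delta X x) R)"
  define \<sigma> where "\<sigma> = lip_linearization X (free_space Z) (compose (vcarrier X) (\<lambda>z\<in>vcarrier Z. delta Z z) S)"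
  note \<rho> = lip_linearization[OF Z FX Lip0_compose(1)[OF R dlt[OF X] Z X FXn], folded \<rho>_def]
  note \<sigma> = lip_linearization[OF X FZ Lip0_compose(1)[OF S dlt[OF Z] X Z FZn], folded \<sigma>_def]
  have \<rho>d: "\<rho> (delta Z z) = delta X (R z)" if "z \<in> vcarrier Z" for z
    using \<rho>(2)[OF that] that Lip0_closed[OF R that] by (simp add: compose_def)
  have \<sigma>d: "\<sigma> (delta X x) = delta Z (S x)" if "x \<in> vcarrier X" for x
    using \<sigma>(2)[OF that] that Lip0_closed[OF S that] by (simp add: compose_def)
  have "compose (vcarrier (free_space Z)) \<sigma> \<rho> = (\<lambda>m\<in>vcarrier (free_space Z). m)"
  proof (rule bounded_ops_free_eqI[OF Z FZn bounded_ops_compose[OF \<rho>(1) \<sigma>(1) FXn FZn FZn]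
        identity_bounded_op[OF FZn]])
    show "compose (vcarrier (free_space Z)) \<sigma> \<rho> (delta Z z) = (\<lambda>m\<in>vcarrier (free_space Z). m) (delta Z z)"
      if "z \<in> vcarrier Z" for z
      using that free_space_closed_subspace(3)[OF Z that] Lip0_closed[OF R that]
      by (simp add: compose_def \<rho>d \<sigma>d SR)
  qed
  then have "\<sigma> (\<rho> m) = m" if "m \<in> vcarrier (free_space Z)" for m
    using that by (metis compose_eq restrict_apply')
  then have "inj_on \<rho> (vcarrier (free_space Z))" by (metis inj_onI)
  then show thesis using that[OF \<rho>(1) \<rho>d] by blast
qed

lemma Lip_ideal_bdd_retract:
  fixes A :: "'u op_family"
  assumes A: "operator_ideal A" and X: "banach_space X" and Z: "banach_space Z"
    and R: "R \<in> bounded_ops Z X" and S: "S \<in> bounded_ops X Z"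
    and SR: "\<And>z. z \<in> vcarrier Z \<Longrightarrow> S (R z) = z"
    and f: "f \<in> Lip_ideal_bdd A l X X"
  shows "compose (vcarrier Z) S (compose (vcarrier Z) f R)
    \<in> Lip_ideal_bdd A (lip_norm X Z S * (l * lip_norm Z X R)) Z Z"
proof -
  note Xn = banach_space.axioms(1)[OF X] and Zn = banach_space.axioms(1)[OF Z]
  have RL: "R \<in> Lip0 Z X" and SL: "S \<in> Lip0 X Z"
    by (rule bounded_ops_Lip0[OF R Zn Xn] bounded_ops_Lip0[OF S Xn Zn])+
  have f0: "f \<in> Lip0 X X" and fl: "lip_norm X X f \<le> l"
    and fA: "in_ideal A (free_space X) X (lip_linearization X X f)"
    using f by (auto simp: Lip_ideal_bdd_def Lip_ideal_def)
  let ?g = "compose (vcarrier Z) S (compose (vcarrier Z) f R)"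
  note fR = Lip0_compose[OF RL f0 Zn Xn Xn]
  note g = Lip0_compose[OF fR(1) SL Zn Xn Zn]
  have "lip_norm Z X (compose (vcarrier Z) f R) \<le> l * lip_norm Z X R"
    using fR(2) mult_right_mono[OF fl lip_norm_nonneg[OF RL Zn Xn]] by linarith
  then have norm: "lip_norm Z Z ?g \<le> lip_norm X Z S * (l * lip_norm Z X R)"
    using g(2) mult_left_mono[OF _ lip_norm_nonneg[OF SL Xn Zn]] by (meson order_trans)
  have FX: "banach_space (free_space X)" and FZ: "banach_space (free_space Z)"
    by (rule free_space_closed_subspace(2)[OF Xn] free_space_closed_subspace(2)[OF Zn])+
  note FXn = banach_space.axioms(1)[OF FX] and FZn = banach_space.axioms(1)[OF FZ]
  obtain \<rho> where \<rho>: "\<rho> \<in> bounded_ops (free_space Z) (free_space X)"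
    "\<And>z. z \<in> vcarrier Z \<Longrightarrow> \<rho> (delta Z z) = delta X (R z)" "inj_on \<rho> (vcarrier (free_space Z))"
    using free_map_injective_of_left_inverse[OF Xn Zn RL SL SR] by blast
  note L = lip_linearization[OF Xn X f0]
  let ?T = "compose (vcarrier (free_space Z)) S
      (compose (vcarrier (free_space Z)) (lip_linearization X X f) \<rho>)"
  have T: "?T \<in> bounded_ops (free_space Z) Z"
    by (rule bounded_ops_compose[OF bounded_ops_compose[OF \<rho>(1) L(1) FXn FZn Xn] S Xn FZn Zn])
  have "lip_linearization Z Z ?g = ?T"
  proof (rule lip_linearization_eqI[OF Zn Z g(1) T])
    show "?T (delta Z z) = ?g z" if z: "z \<in> vcarrier Z" for z
      using z free_space_closed_subspace(3)[OF Zn z] bounded_ops_closed[OF R z]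
      by (simp add: compose_def \<rho>(2) L(2))
  qed
  moreover have "in_ideal A (free_space Z) Z ?T"
  proof (rule in_ideal_compose[OF A FX X FZ Z fA \<rho>(1) S \<rho>(3)])
    show "\<rho> ` vcarrier (free_space Z) \<subseteq> vcarrier (free_space X)"
      using bounded_ops_closed[OF \<rho>(1)] by blast
    show "inj_on R (vcarrier Z)" using SR by (metis inj_onI)
    show "R ` vcarrier Z \<subseteq> vcarrier X" using bounded_ops_closed[OF R] by blast
  qed
  ultimately show ?thesis
    using g(1) norm by (simp add: Lip_ideal_bdd_def Lip_ideal_def)
qed

theorem Lip_BAP_retract:
  fixes A :: "'u op_family"
  assumes A: "operator_ideal A" and X: "banach_space X" and Z: "banach_space Z"
    and R: "R \<in> bounded_ops Z X" and S: "S \<in> bounded_ops X Z"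
    and SR: "\<And>z. z \<in> vcarrier Z \<Longrightarrow> S (R z) = z"
    and BAP: "Lip_BAP A X"
  shows "Lip_BAP A Z"
proof -
  interpret X: banach_space X by fact
  interpret Z: banach_space Z by fact
  note Xn = X.normed_space_axioms and Zn = Z.normed_space_axioms
  obtain l where id: "(\<lambda>x\<in>vcarrier X. x) \<in> tau_c X X closure_of Lip_ideal_bdd A l X X"
    using BAP by (auto simp: Lip_BAP_def)
  let ?\<Phi> = "\<lambda>f. compose (vcarrier Z) S (compose (vcarrier Z) f R)"
  \<comment> \<open>The maximum with 1 only serves to have a bound \<open>\<ge> 1\<close>, as the definition of the property demands.\<close>
  define l' where "l' = max 1 (lip_norm X Z S * (l * lip_norm Z X R))"
  have "continuous_map (tau_c X X) (tau_c Z Z) ?\<Phi>"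
    by (intro continuous_map_conjugate_tau_c Lip0_continuous bounded_ops_Lip0 R S Xn Zn
        X.topspace_vtop Z.topspace_vtop)
  then have "?\<Phi> (\<lambda>x\<in>vcarrier X. x) \<in> tau_c Z Z closure_of (?\<Phi> ` Lip_ideal_bdd A l X X)"
    using id continuous_map_image_closure_subset by blast
  also have "?\<Phi> (\<lambda>x\<in>vcarrier X. x) = (\<lambda>z\<in>vcarrier Z. z)"
    using bounded_ops_closed[OF R] SR by (auto simp: compose_def)
  also have "tau_c Z Z closure_of (?\<Phi> ` Lip_ideal_bdd A l X X)
      \<subseteq> tau_c Z Z closure_of (Lip_ideal_bdd A l' Z Z)"
  proof (rule closure_of_mono, rule image_subsetI)
    fix f assume "f \<in> Lip_ideal_bdd A l X X"
    from Lip_ideal_bdd_retract[OF A X Z R S SR this]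
    show "?\<Phi> f \<in> Lip_ideal_bdd A l' Z Z"
      unfolding Lip_ideal_bdd_def l'_def by fastforce
  qed
  finally have "(\<lambda>z\<in>vcarrier Z. z) \<in> tau_c Z Z closure_of Lip_ideal_bdd A l' Z Z" .
  moreover have "l' \<ge> 1" by (simp add: l'_def)
  ultimately show ?thesis unfolding Lip_BAP_def by blast
qed


section \<open>Quotients by closed subspaces\<close>

context normed_space
begin

context
  fixes M
  assumes M: "linear_subspace V M"
begin

abbreviation coset :: "'a \<Rightarrow> 'a set" where
  "coset x \<equiv> vadd V x ` M"

lemma M_closed:
  "m \<in> M \<Longrightarrow> m \<in> vcarrier V" "vzero V \<in> M" "\<lbrakk>m \<in> M; n \<in> M\<rbrakk> \<Longrightarrow> vadd V m n \<in> M"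
  "m \<in> M \<Longrightarrow> vscale V a m \<in> M"
  using M by (auto simp: linear_subspace_def)

lemma coset_add_mem:
  assumes x: "x \<in> vcarrier V" and m: "m \<in> M"
  shows "coset (vadd V x m) = coset x"
proof
  show "coset (vadd V x m) \<subseteq> coset x"
    using x m by (auto simp: add_assoc M_closed)
  show "coset x \<subseteq> coset (vadd V x m)"
  proof
    fix c assume "c \<in> coset x"
    then obtain n where n: "n \<in> M" "c = vadd V x n" by blast
    have "vadd V m (vdiff V n m) = n" "vdiff V n m \<in> M"
      using n m by (auto simp: add_diff_self M_closed subspace_diff_closed[OF M])
    then have "c = vadd V (vadd V x m) (vdiff V n m)"
      using x n m by (simp add: add_assoc M_closed)
    then show "c \<in> coset (vadd V x m)" using \<open>vdiff V n m \<in> M\<close> by blast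
  qed
qed

lemma coset_zero: "coset (vzero V) = M"
  using zero_add M_closed(1) by (auto simp: image_iff)

lemma mem_coset: "x \<in> vcarrier V \<Longrightarrow> x \<in> coset x"
  using add_zero M_closed(2) by (metis image_eqI)

lemma quotient_carrier: "vcarrier (quotient_space V M) = coset ` vcarrier V"
  by (simp add: quotient_space_def)

lemma quotient_zero: "vzero (quotient_space V M) = coset (vzero V)"
  by (simp add: quotient_space_def coset_zero)

lemma quotient_add:
  assumes "x \<in> vcarrier V" "y \<in> vcarrier V"
  shows "vadd (quotient_space V M) (coset x) (coset y) = coset (vadd V x y)"
proof -
  have eq: "vadd V (vadd V x m) (vadd V y n) = vadd V (vadd V x y) (vadd V m n)"
    if "m \<in> M" "n \<in> M" for m n
    using assms that
    by (simp add: add_assoc add_closed M_closed add_left_commute[of m y])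
  have "{vadd V c d | c d. c \<in> coset x \<and> d \<in> coset y} = coset (vadd V x y)"
  proof
    show "{vadd V c d | c d. c \<in> coset x \<and> d \<in> coset y} \<subseteq> coset (vadd V x y)"
      using eq M_closed(3) by blast
    show "coset (vadd V x y) \<subseteq> {vadd V c d | c d. c \<in> coset x \<and> d \<in> coset y}"
    proof
      fix c assume "c \<in> coset (vadd V x y)"
      then obtain m where m: "m \<in> M" "c = vadd V (vadd V x y) m" by blast
      then have "c = vadd V x (vadd V y m)" using assms by (simp add: add_assoc M_closed)
      then show "c \<in> {vadd V c d | c d. c \<in> coset x \<and> d \<in> coset y}"
        using m mem_coset[OF assms(1)] by blast
    qed
  qed
  then show ?thesis by (simp add: quotient_space_def)
qed

lemma quotient_scale:
  assumes "x \<in> vcarrier V"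
  shows "vscale (quotient_space V M) a (coset x) = coset (vscale V a x)"
proof -
  have eq: "vadd V (vscale V a (vadd V x m)) n = vadd V (vscale V a x) (vadd V (vscale V a m) n)"
    if "m \<in> M" "n \<in> M" for m n
    using assms that by (simp add: scale_add_right add_assoc scale_closed M_closed)
  have "{vadd V (vscale V a c) m | c m. c \<in> coset x \<and> m \<in> M} = coset (vscale V a x)"
  proof
    show "{vadd V (vscale V a c) m | c m. c \<in> coset x \<and> m \<in> M} \<subseteq> coset (vscale V a x)"
      using eq M_closed(3,4) by blast
    show "coset (vscale V a x) \<subseteq> {vadd V (vscale V a c) m | c m. c \<in> coset x \<and> m \<in> M}"
      using mem_coset[OF assms] by blast
  qed
  then show ?thesis by (simp add: quotient_space_def)
qed

lemma quotient_diff: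
  "\<lbrakk>x \<in> vcarrier V; y \<in> vcarrier V\<rbrakk>
    \<Longrightarrow> vdiff (quotient_space V M) (coset x) (coset y) = coset (vdiff V x y)"
  by (simp add: vdiff_def quotient_add quotient_scale scale_closed)

lemma quotient_norm_le:
  assumes "x \<in> vcarrier V" "c \<in> coset x"
  shows "vnorm (quotient_space V M) (coset x) \<le> vnorm V c"
proof -
  have "bdd_below (vnorm V ` coset x)"
    using assms by (intro bdd_belowI[of _ 0]) (auto simp: norm_nonneg add_closed M_closed(1))
  then show ?thesis
    using assms by (auto simp: quotient_space_def intro!: cINF_lower)
qed

lemma quotient_norm_greatest:
  assumes "x \<in> vcarrier V" "\<And>m. m \<in> M \<Longrightarrow> r \<le> vnorm V (vadd V x m)"
  shows "r \<le> vnorm (quotient_space V M) (coset x)"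
proof -
  have "r \<le> (INF c\<in>coset x. vnorm V c)"
    using assms M_closed(2) by (intro cINF_greatest) auto
  then show ?thesis by (simp add: quotient_space_def)
qed

lemma quotient_norm_nonneg: "x \<in> vcarrier V \<Longrightarrow> 0 \<le> vnorm (quotient_space V M) (coset x)"
  by (intro quotient_norm_greatest) (auto simp: norm_nonneg add_closed M_closed(1))

text \<open>
  Closedness of \<open>M\<close> makes the quotient seminorm a norm: if \<open>x + M\<close> has norm 0, then \<open>x\<close> is a limit of
  elements of \<open>M\<close>.
\<close>

lemma normed_space_quotient:
  assumes cl: "vtop V closure_of M \<subseteq> M"
  shows "normed_space (quotient_space V M)"
proof -
  let ?Q = "quotient_space V M"
  note ops = quotient_zero quotient_add quotient_scale quotient_diff zero_closed add_closed
    scale_closed diff_closed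
  have repr: "\<exists>x\<in>vcarrier V. C = coset x" if "C \<in> vcarrier ?Q" for C
    using that by (auto simp: quotient_carrier)
  have inQ: "coset x \<in> vcarrier ?Q" if "x \<in> vcarrier V" for x
    using that by (auto simp: quotient_carrier)
  have norm0: "vnorm ?Q (coset (vzero V)) = 0"
    using quotient_norm_le[OF zero_closed mem_coset[OF zero_closed]]
      quotient_norm_nonneg[OF zero_closed] norm_zero by linarith
  have norm_zero_mem: "x \<in> M" if x: "x \<in> vcarrier V" and z: "vnorm ?Q (coset x) = 0" for x
  proof -
    have "\<exists>y\<in>M. vdist V x y < e" if e: "e > 0" for e
    proof (rule ccontr)
      assume far: "\<not> (\<exists>y\<in>M. vdist V x y < e)"
      have "e \<le> vnorm V (vadd V x m)" if "m \<in> M" for m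
      proof -
        have "vdist V x (vscale V (-1) m) = vnorm V (vadd V x m)"
          using x that by (simp add: vdist_eq vdiff_def scale_closed M_closed scale_scale scale_one)
        then show ?thesis using far M_closed(4)[OF that, of "-1"] by fastforce
      qed
      then have "e \<le> vnorm ?Q (coset x)" by (rule quotient_norm_greatest[OF x])
      then show False using z e by simp
    qed
    then have "x \<in> vtop V closure_of M"
      using x M in_closure_iff[of M x] by (auto simp: linear_subspace_def)
    then show ?thesis using cl by blast
  qed
  have scale_le: "vnorm ?Q (coset (vscale V a x)) \<le> \<bar>a\<bar> * vnorm ?Q (coset x)"
    if x: "x \<in> vcarrier V" and a: "a \<noteq> 0" for a x
  proof -
    have "inverse \<bar>a\<bar> * vnorm ?Q (coset (vscale V a x)) \<le> vnorm V (vadd V x m)" if m: "m \<in> M" for m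
    proof -
      have "vadd V (vscale V a x) (vscale V a m) \<in> coset (vscale V a x)"
        using m by (auto intro: M_closed)
      from quotient_norm_le[OF scale_closed[OF x] this]
      have "vnorm ?Q (coset (vscale V a x)) \<le> \<bar>a\<bar> * vnorm V (vadd V x m)"
        using x m by (simp add: M_closed add_closed norm_scale flip: scale_add_right)
      then show ?thesis using a by (simp add: field_simps)
    qed
    then have "inverse \<bar>a\<bar> * vnorm ?Q (coset (vscale V a x)) \<le> vnorm ?Q (coset x)"
      by (rule quotient_norm_greatest[OF x])
    then show ?thesis using a by (simp add: field_simps)
  qed
  show ?thesis
  proof
    show "vzero ?Q \<in> vcarrier ?Q" by (simp add: quotient_zero inQ zero_closed)
    fix C assume "C \<in> vcarrier ?Q"
    then obtain x where x: "x \<in> vcarrier V" and C: "C = coset x" using repr by blast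
    show "vadd ?Q C (vzero ?Q) = C" using x by (simp add: C ops add_zero)
    show "vdiff ?Q C C = vzero ?Q" using x by (simp add: C ops add_inverse)
    show "vscale ?Q 1 C = C" using x by (simp add: C ops scale_one)
    show "0 \<le> vnorm ?Q C" using x by (simp add: C quotient_norm_nonneg)
    show "vnorm ?Q C = 0 \<longleftrightarrow> C = vzero ?Q"
    proof
      assume "vnorm ?Q C = 0"
      then have "x \<in> M" using norm_zero_mem x by (simp add: C)
      then show "C = vzero ?Q"
        using coset_add_mem[OF zero_closed, of x] x by (simp add: C quotient_zero zero_add)
    qed (simp add: quotient_zero norm0)
    fix a b
    show "vscale ?Q a C \<in> vcarrier ?Q" using x by (simp add: C ops inQ)
    show "vscale ?Q (a + b) C = vadd ?Q (vscale ?Q a C) (vscale ?Q b C)"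
      using x by (simp add: C ops scale_add_left)
    show "vscale ?Q a (vscale ?Q b C) = vscale ?Q (a * b) C"
      using x by (simp add: C ops scale_scale)
    show "vnorm ?Q (vscale ?Q a C) = \<bar>a\<bar> * vnorm ?Q C"
    proof (cases "a = 0")
      case True
      then show ?thesis using x by (simp add: C ops scale_zero_left norm0)
    next
      case False
      have "vscale V (inverse a) (vscale V a x) = x" using x False by (simp add: scale_scale scale_one)
      then have "vnorm ?Q (coset x) \<le> \<bar>inverse a\<bar> * vnorm ?Q (coset (vscale V a x))"
        using scale_le[OF scale_closed[OF x, of a], of "inverse a"] False by simp
      then have "\<bar>a\<bar> * vnorm ?Q (coset x) \<le> vnorm ?Q (coset (vscale V a x))"
        using False by (simp add: field_simps)
      then show ?thesis using scale_le[OF x False] x by (simp add: C ops)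
    qed
    fix D assume "D \<in> vcarrier ?Q"
    then obtain y where y: "y \<in> vcarrier V" and D: "D = coset y" using repr by blast
    show "vadd ?Q C D \<in> vcarrier ?Q" using x y by (simp add: C D ops inQ)
    show "vadd ?Q C D = vadd ?Q D C" using x y by (simp add: C D ops add_commute)
    show "vscale ?Q a (vadd ?Q C D) = vadd ?Q (vscale ?Q a C) (vscale ?Q a D)"
      using x y by (simp add: C D ops scale_add_right)
    show "vnorm ?Q (vadd ?Q C D) \<le> vnorm ?Q C + vnorm ?Q D"
    proof -
      let ?N = "vnorm ?Q (coset (vadd V x y))"
      have le: "?N - vnorm V (vadd V y n) \<le> vnorm V (vadd V x m)" if "m \<in> M" "n \<in> M" for m n
      proof -
        have "vadd V (vadd V x m) (vadd V y n) = vadd V (vadd V x y) (vadd V m n)"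
          using x y that by (simp add: add_assoc add_closed M_closed add_left_commute[of m y])
        then have "?N \<le> vnorm V (vadd V (vadd V x m) (vadd V y n))"
          using x y that M_closed(3) by (intro quotient_norm_le add_closed) auto
        also have "\<dots> \<le> vnorm V (vadd V x m) + vnorm V (vadd V y n)"
          using x y that by (intro norm_triangle add_closed) (auto intro: M_closed(1))
        finally show ?thesis by simp
      qed
      then have "?N - vnorm V (vadd V y n) \<le> vnorm ?Q (coset x)" if "n \<in> M" for n
        using that by (intro quotient_norm_greatest[OF x])
      then have "?N - vnorm ?Q (coset x) \<le> vnorm V (vadd V y n)" if "n \<in> M" for n
        using that by (simp add: algebra_simps)
      then have "?N - vnorm ?Q (coset x) \<le> vnorm ?Q (coset y)"
        by (rule quotient_norm_greatest[OF y])
      then show ?thesis using x y by (simp add: C D ops)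
    qed
    fix E assume "E \<in> vcarrier ?Q"
    then obtain z where z: "z \<in> vcarrier V" and E: "E = coset z" using repr by blast
    show "vadd ?Q (vadd ?Q C D) E = vadd ?Q C (vadd ?Q D E)"
      using x y z by (simp add: C D E ops add_assoc)
  qed
qed

end

end


section \<open>Complemented subspaces and their quotients are retracts\<close>

text \<open>
  The range of a projection is its set of fixed points, and the fixed points of a continuous map form
  a closed set.
\<close>

lemma complemented_subspace_closed:
  assumes X: "normed_space X" and P: "P \<in> bounded_ops X X"
    and PP: "\<And>x. x \<in> vcarrier X \<Longrightarrow> P (P x) = P x"
  shows "linear_subspace X (P ` vcarrier X)"
    and "vtop X closure_of (P ` vcarrier X) \<subseteq> P ` vcarrier X"
proof -
  interpret normed_space X by fact
  note lin = bounded_ops_linear[OF P]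
  have Pin: "P x \<in> vcarrier X" if "x \<in> vcarrier X" for x by (rule bounded_ops_closed[OF P that])
  let ?M = "P ` vcarrier X"
  show sub: "linear_subspace X ?M"
    unfolding linear_subspace_def
  proof (intro conjI ballI allI)
    show "?M \<subseteq> vcarrier X" using Pin by blast
    show "vzero X \<in> ?M"
      using linear_maps_zero[OF lin X X] zero_closed by (metis image_eqI)
    show "vadd X x y \<in> ?M" if "x \<in> ?M" "y \<in> ?M" for x y
      using that by (auto simp: add_closed simp flip: linear_maps_add[OF lin])
    show "vscale X a x \<in> ?M" if "x \<in> ?M" for a x
      using that by (auto simp: scale_closed simp flip: linear_maps_scale[OF lin])
  qed
  then have MX: "?M \<subseteq> vcarrier X" by (simp add: linear_subspace_def)
  obtain K where K: "K \<ge> 0" "\<And>x. x \<in> vcarrier X \<Longrightarrow> vnorm X (P x) \<le> K * vnorm X x"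
    using bounded_ops_bound[OF P X] by blast
  show "vtop X closure_of ?M \<subseteq> ?M"
  proof
    fix x assume "x \<in> vtop X closure_of ?M"
    then have x: "x \<in> vcarrier X" and near: "\<And>e. e > 0 \<Longrightarrow> \<exists>m\<in>?M. vdist X x m < e"
      using in_closure_iff[OF MX] by auto
    have "vdist X x (P x) \<le> 0 + e" if e: "e > 0" for e
    proof -
      obtain m where m: "m \<in> ?M" "vdist X x m < e / (1 + K)"
        using near[of "e / (1 + K)"] e K(1) by auto
      have mX: "m \<in> vcarrier X" and Pm: "P m = m" using m(1) Pin PP by auto
      have "vdist X x (P x) \<le> vdist X x m + vdist X (P m) (P x)"
        using metric.triangle[OF x mX Pin[OF x]] Pm by simp
      also have "vdist X (P m) (P x) \<le> K * vdist X m x"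
        by (rule bounded_ops_vdist[OF P X X K(2) mX x])
      also have "vdist X x m + K * vdist X m x = (1 + K) * vdist X x m"
        by (simp add: metric.commute distrib_right)
      also have "\<dots> \<le> e" using m(2) K(1) by (simp add: field_simps)
      finally show ?thesis by simp
    qed
    then have "vdist X x (P x) \<le> 0" by (rule field_le_epsilon)
    then have "vdist X x (P x) = 0" using metric.nonneg[of x "P x"] by linarith
    then have "x = P x" using metric.zero[OF x Pin[OF x]] by simp
    then show "x \<in> ?M" using x by blast
  qed
qed

text \<open>
  The map \<open>x \<mapsto> x - P x\<close> vanishes on the range of \<open>P\<close>, hence factors through a bounded operator
  \<open>R\<close> on the quotient; as \<open>x - P x\<close> is a representative of the coset of \<open>x\<close>, the quotient map is a
  left inverse of \<open>R\<close>.
\<close>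

lemma quotient_by_projection_section:
  assumes X: "normed_space X" and P: "P \<in> bounded_ops X X"
    and PP: "\<And>x. x \<in> vcarrier X \<Longrightarrow> P (P x) = P x"
  defines "Q \<equiv> quotient_space X (P ` vcarrier X)"
  obtains R S where "R \<in> bounded_ops Q X" "S \<in> bounded_ops X Q"
    "\<And>C. C \<in> vcarrier Q \<Longrightarrow> S (R C) = C"
proof -
  interpret normed_space X by fact
  let ?M = "P ` vcarrier X"
  have M: "linear_subspace X ?M" using complemented_subspace_closed(1)[OF X P] PP by blast
  let ?c = "\<lambda>x. vadd X x ` ?M"
  note lin = bounded_ops_linear[OF P]
  have Pin: "P x \<in> vcarrier X" if "x \<in> vcarrier X" for x by (rule bounded_ops_closed[OF P that])
  define J where "J x = vdiff X x (P x)" for x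
  have J_in: "J x \<in> vcarrier X" if "x \<in> vcarrier X" for x
    using that by (simp add: J_def diff_closed Pin)
  have J_mem: "J c = J x" if x: "x \<in> vcarrier X" and c: "c \<in> ?c x" for x c
  proof -
    obtain m where m: "m \<in> vcarrier X" "P m = m" "c = vadd X x m" using c Pin PP by auto
    show ?thesis
      using x m Pin[OF x] linear_maps_add[OF lin x m(1)]
      by (simp add: J_def diff_add_add add_inverse add_zero diff_closed)
  qed
  have J_add: "J (vadd X x y) = vadd X (J x) (J y)" if "x \<in> vcarrier X" "y \<in> vcarrier X" for x y
    using that Pin by (simp add: J_def linear_maps_add[OF lin] diff_add_add)
  have J_scale: "J (vscale X a x) = vscale X a (J x)" if "x \<in> vcarrier X" for a x
    using that Pin by (simp add: J_def linear_maps_scale[OF lin] diff_scale)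
  have J_coset: "?c (J x) = ?c x" if x: "x \<in> vcarrier X" for x
    using coset_add_mem[OF M x, of "vscale X (-1) (P x)"] x M
    by (simp add: J_def vdiff_def linear_subspace_def)
  define R where "R = (\<lambda>C\<in>vcarrier Q. J (SOME x. x \<in> C))"
  define S where "S = (\<lambda>x\<in>vcarrier X. ?c x)"
  have inQ: "?c x \<in> vcarrier Q" if "x \<in> vcarrier X" for x
    using that by (auto simp: Q_def quotient_carrier[OF M])
  have R: "R (?c x) = J x" if x: "x \<in> vcarrier X" for x
  proof -
    have "(SOME y. y \<in> ?c x) \<in> ?c x" using mem_coset[OF M x] by (rule someI)
    then show ?thesis using J_mem[OF x] inQ[OF x] by (simp add: R_def)
  qed
  have repr: "\<exists>x\<in>vcarrier X. C = ?c x" if "C \<in> vcarrier Q" for C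
    using that by (auto simp: Q_def quotient_carrier[OF M])
  obtain K where K: "K \<ge> 0" "\<And>x. x \<in> vcarrier X \<Longrightarrow> vnorm X (P x) \<le> K * vnorm X x"
    using bounded_ops_bound[OF P X] by blast
  have R_bound: "vnorm X (R C) \<le> (1 + K) * vnorm Q C" if "C \<in> vcarrier Q" for C
  proof -
    obtain x where x: "x \<in> vcarrier X" "C = ?c x" using repr \<open>C \<in> vcarrier Q\<close> by blast
    \<comment> \<open>The value of \<open>J\<close> is the same at every element of the coset, so the estimate
      \<open>\<parallel>J c\<parallel> \<le> (1 + K) \<parallel>c\<parallel>\<close> passes to the infimum over \<open>c\<close>.\<close>
    have "vnorm X (J x) / (1 + K) \<le> vnorm X (vadd X x m)" if m: "m \<in> ?M" for m
    proof -
      have c: "vadd X x m \<in> vcarrier X" "vadd X x m \<in> ?c x"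
        using x m Pin by (auto intro: add_closed)
      have "vnorm X (J x) = vnorm X (J (vadd X x m))" using J_mem[OF x(1) c(2)] by simp
      also have "\<dots> \<le> vnorm X (vadd X x m) + vnorm X (P (vadd X x m))"
        using c(1) Pin by (simp add: J_def norm_diff_le)
      also have "\<dots> \<le> (1 + K) * vnorm X (vadd X x m)"
        using K(2)[OF c(1)] by (simp add: distrib_right)
      finally show ?thesis using K(1) by (simp add: pos_divide_le_eq mult.commute)
    qed
    then have "vnorm X (J x) / (1 + K) \<le> vnorm Q (?c x)"
      unfolding Q_def by (rule quotient_norm_greatest[OF M x(1)])
    then show ?thesis using K(1) x R by (simp add: pos_divide_le_eq mult.commute)
  qed
  have "R \<in> linear_maps Q X"
    unfolding linear_maps_def
  proof (intro CollectI conjI ballI allI)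
    show "R \<in> vcarrier Q \<rightarrow>\<^sub>E vcarrier X"
    proof (rule PiE_I)
      show "R C \<in> vcarrier X" if "C \<in> vcarrier Q" for C
        using repr[OF that] R J_in by auto
    qed (simp add: R_def)
    fix C assume "C \<in> vcarrier Q"
    then obtain x where x: "x \<in> vcarrier X" "C = ?c x" using repr by blast
    show "R (vscale Q a C) = vscale X a (R C)" for a
      using x by (simp add: Q_def quotient_scale[OF M] R J_scale scale_closed)
    fix D assume "D \<in> vcarrier Q"
    then obtain y where y: "y \<in> vcarrier X" "D = ?c y" using repr by blast
    show "R (vadd Q C D) = vadd X (R C) (R D)"
      using x y by (simp add: Q_def quotient_add[OF M] R J_add add_closed)
  qed
  then have RB: "R \<in> bounded_ops Q X" using R_bound by (auto simp: bounded_ops_def)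
  have "vnorm Q (?c x) \<le> 1 * vnorm X x" if "x \<in> vcarrier X" for x
    using quotient_norm_le[OF M that mem_coset[OF M that]] by (simp add: Q_def)
  then have "\<exists>K. \<forall>x\<in>vcarrier X. vnorm Q (?c x) \<le> K * vnorm X x" by blast
  moreover have "S \<in> linear_maps X Q"
    using inQ by (auto simp: linear_maps_def S_def add_closed scale_closed)
      (simp_all add: Q_def quotient_add[OF M] quotient_scale[OF M])
  ultimately have SB: "S \<in> bounded_ops X Q" by (simp add: bounded_ops_def S_def)
  have "S (R C) = C" if C: "C \<in> vcarrier Q" for C
  proof -
    obtain x where x: "x \<in> vcarrier X" "C = ?c x" using repr[OF C] by blast
    then show ?thesis using J_coset[OF x(1)] J_in[OF x(1)] by (simp only: R S_def restrict_apply')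
  qed
  then show thesis using that[OF RB SB] by blast
qed

theorem proposition4p1:
  fixes A :: "'u op_family" and X :: "'a nspace" and M :: "'a set"
  assumes "operator_ideal A"
    and "banach_space X"
    and "complemented_subspace X M"
    and "Lip_BAP A X"
  shows "Lip_BAP A (sub_space X M) \<and> Lip_BAP A (quotient_space X M)"
proof
  interpret X: banach_space X by fact
  note Xn = X.normed_space_axioms
  obtain P where P: "P \<in> bounded_ops X X" and PP: "\<And>x. x \<in> vcarrier X \<Longrightarrow> P (P x) = P x"
    and M: "M = P ` vcarrier X"
    using assms(3) by (auto simp: complemented_subspace_def)
  have sub: "linear_subspace X M" and cl: "vtop X closure_of M \<subseteq> M"
    unfolding M by (rule complemented_subspace_closed[OF Xn P PP], assumption)+
  have PM: "P \<in> bounded_ops X (sub_space X M)"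
    using P by (auto simp: bounded_ops_def linear_maps_def M)
  have incl: "(\<lambda>m\<in>M. m) \<in> bounded_ops (sub_space X M) X"
    using sub by (auto simp: bounded_ops_def linear_maps_def linear_subspace_def intro!: exI[of _ 1])
  have PmM: "P ((\<lambda>m\<in>M. m) m) = m" if "m \<in> vcarrier (sub_space X M)" for m
    using that PP by (auto simp: M)
  show "Lip_BAP A (sub_space X M)"
    by (rule Lip_BAP_retract[OF assms(1,2) banach_space_sub_space[OF assms(2) sub cl] incl PM PmM
          assms(4)])
  obtain R S where RS: "R \<in> bounded_ops (quotient_space X M) X"
    "S \<in> bounded_ops X (quotient_space X M)"
    "\<And>C. C \<in> vcarrier (quotient_space X M) \<Longrightarrow> S (R C) = C"
    using quotient_by_projection_section[OF Xn P PP] unfolding M by blast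
  have "banach_space (quotient_space X M)"
    by (rule banach_space_retract[OF X.normed_space_quotient[OF sub cl] assms(2) RS])
  then show "Lip_BAP A (quotient_space X M)"
    by (rule Lip_BAP_retract[OF assms(1,2) _ RS assms(4)])
qed

end
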